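(* There are $\Delta_2$-definable deductively-closed probability functions on $\mathcal{SL}_A$; that is, there exists a function $P:\mathcal{SL}_A\to[0,1]$ that is deductively closed over $\mathsf{PA}$ and $\Delta_2$-definable.
   Context: $\mathcal{L}_A$ is the first-order language of arithmetic with symbols $0,S,+,\times,x^y,<$; $\mathcal{SL}_A$ is its set of sentences; $\mathsf{PA}$ is first-order Peano arithmetic in this language. A deductively-closed probability function on $\mathcal{SL}_A$ is a function $P:\mathcal{SL}_A\to[0,1]$ such that: (D1) if $\mathsf{PA}\vdash\varphi$ then $P(\varphi)=1$; (D2) if $\mathsf{PA}\vdash\neg(\varphi\land\psi)$ then $P(\varphi\lor\psi)=P(\varphi)+P(\psi)$. Arithmetical hierarchy: $\Delta_0=\Sigma_0=\Pi_0$ formulas are those with only bounded quantifiers; $\Sigma_{n+1}$ formulas are of the form $\exists x_1\cdots\exists x_m\,\psi$ with $\psi$ in $\Pi_n$; $\Pi_{n+1}$ formulas are of the form $\forall x_1\cdots\forall x_m\,\psi$ with $\psi$ in $\Sigma_n$; a formula is $\Delta_n$ if $\mathsf{PA}$ proves it equivalent both to a $\Sigma_n$ formula and to a $\Pi_n$ formula. Definability: Fix a standard Gödel numbering $\ulcorner\cdot\urcorner$ of formulas, and identify $P$ with the function $\ulcorner\varphi\urcorner\mapsto P(\varphi)$ on codes of sentences. Rationals are coded in arithmetic in the standard way. A rational-valued function $g$ is defined by an $\mathcal{L}_A$-formula $\varphi$ if $g(\vec x)=y\leftrightarrow\varphi(\vec x,y)$ and $\mathsf{PA}$ proves that for all arguments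 $\vec x$ in the domain there is a unique $y$ with $\varphi(\vec x,y)$. A rational-valued function $g$ is an approximation for a real-valued function $f$ if $\mathrm{dom}(g)=\mathrm{dom}(f)\times\omega$ and $|f(\vec x)-g(\vec x,n)|\le 2^{-n}$ for all $\vec x\in\mathrm{dom}(f)$, $n\in\omega$. A real-valued function $f$ is $\Delta_n$-definable (resp. $\Sigma_n$-, $\Pi_n$-definable) if it has an approximation defined by a $\Delta_n$ (resp. $\Sigma_n$, $\Pi_n$) formula. *)

theory Defs
  imports Complex_Main "HOL-Library.Nat_Bijection" "HOL-Library.More_List"
begin

section \<open>Syntax and the standard model\<close>

text \<open>Variables are de Bruijn indices.\<close>

datatype tm = Var nat | Zero | Succ tm | Plus tm tm | Times tm tm | Expt tm tm

datatype fm = Eq tm tm | Less tm tm | Neg fm | And fm fm | Or fm fm | Imp fm fm | All fm | Ex fm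

definition Iff :: "fm \<Rightarrow> fm \<Rightarrow> fm" where
  "Iff \<phi> \<psi> = And (Imp \<phi> \<psi>) (Imp \<psi> \<phi>)"

fun eval :: "(nat \<Rightarrow> nat) \<Rightarrow> tm \<Rightarrow> nat" where
  "eval e (Var i) = e i"
| "eval e Zero = 0"
| "eval e (Succ t) = Suc (eval e t)"
| "eval e (Plus s t) = eval e s + eval e t"
| "eval e (Times s t) = eval e s * eval e t"
| "eval e (Expt s t) = eval e s ^ eval e t"

fun sat :: "(nat \<Rightarrow> nat) \<Rightarrow> fm \<Rightarrow> bool" where
  "sat e (Eq s t) \<longleftrightarrow> eval e s = eval e t"
| "sat e (Less s t) \<longleftrightarrow> eval e s < eval e t"
| "sat e (Neg \<phi>) \<longleftrightarrow> \<not> sat e \<phi>"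
| "sat e (And \<phi> \<psi>) \<longleftrightarrow> sat e \<phi> \<and> sat e \<psi>"
| "sat e (Or \<phi> \<psi>) \<longleftrightarrow> sat e \<phi> \<or> sat e \<psi>"
| "sat e (Imp \<phi> \<psi>) \<longleftrightarrow> (sat e \<phi> \<longrightarrow> sat e \<psi>)"
| "sat e (All \<phi>) \<longleftrightarrow> (\<forall>a. sat (case_nat a e) \<phi>)"
| "sat e (Ex \<phi>) \<longleftrightarrow> (\<exists>a. sat (case_nat a e) \<phi>)"

text \<open>In \<open>holds \<phi> xs\<close>, variable \<open>i\<close> denotes \<open>xs ! i\<close>.\<close>

definition holds :: "fm \<Rightarrow> nat list \<Rightarrow> bool" where
  "holds \<phi> xs \<longleftrightarrow> sat (nth_default 0 xs) \<phi>"

fun tm_below :: "nat \<Rightarrow> tm \<Rightarrow> bool" where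
  "tm_below d (Var i) \<longleftrightarrow> i < d"
| "tm_below d Zero \<longleftrightarrow> True"
| "tm_below d (Succ t) \<longleftrightarrow> tm_below d t"
| "tm_below d (Plus s t) \<longleftrightarrow> tm_below d s \<and> tm_below d t"
| "tm_below d (Times s t) \<longleftrightarrow> tm_below d s \<and> tm_below d t"
| "tm_below d (Expt s t) \<longleftrightarrow> tm_below d s \<and> tm_below d t"

text \<open>\<open>fm_below d \<phi>\<close>: all free variables of \<open>\<phi>\<close> have index less than \<open>d\<close>.\<close>

fun fm_below :: "nat \<Rightarrow> fm \<Rightarrow> bool" where
  "fm_below d (Eq s t) \<longleftrightarrow> tm_below d s \<and> tm_below d t"
| "fm_below d (Less s t) \<longleftrightarrow> tm_below d s \<and> tm_below d t"
| "fm_below d (Neg \<phi>) \<longleftrightarrow> fm_below d \<phi>"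
| "fm_below d (And \<phi> \<psi>) \<longleftrightarrow> fm_below d \<phi> \<and> fm_below d \<psi>"
| "fm_below d (Or \<phi> \<psi>) \<longleftrightarrow> fm_below d \<phi> \<and> fm_below d \<psi>"
| "fm_below d (Imp \<phi> \<psi>) \<longleftrightarrow> fm_below d \<phi> \<and> fm_below d \<psi>"
| "fm_below d (All \<phi>) \<longleftrightarrow> fm_below (Suc d) \<phi>"
| "fm_below d (Ex \<phi>) \<longleftrightarrow> fm_below (Suc d) \<phi>"

definition sentences :: "fm set" where
  "sentences = {\<phi>. fm_below 0 \<phi>}"

section \<open>Lifting and substitution\<close>

fun lift_tm :: "nat \<Rightarrow> tm \<Rightarrow> tm" where
  "lift_tm k (Var i) = Var (if i < k then i else Suc i)"
| "lift_tm k Zero = Zero"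
| "lift_tm k (Succ t) = Succ (lift_tm k t)"
| "lift_tm k (Plus s t) = Plus (lift_tm k s) (lift_tm k t)"
| "lift_tm k (Times s t) = Times (lift_tm k s) (lift_tm k t)"
| "lift_tm k (Expt s t) = Expt (lift_tm k s) (lift_tm k t)"

fun lift_fm :: "nat \<Rightarrow> fm \<Rightarrow> fm" where
  "lift_fm k (Eq s t) = Eq (lift_tm k s) (lift_tm k t)"
| "lift_fm k (Less s t) = Less (lift_tm k s) (lift_tm k t)"
| "lift_fm k (Neg \<phi>) = Neg (lift_fm k \<phi>)"
| "lift_fm k (And \<phi> \<psi>) = And (lift_fm k \<phi>) (lift_fm k \<psi>)"
| "lift_fm k (Or \<phi> \<psi>) = Or (lift_fm k \<phi>) (lift_fm k \<psi>)"
| "lift_fm k (Imp \<phi> \<psi>) = Imp (lift_fm k \<phi>) (lift_fm k \<psi>)"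
| "lift_fm k (All \<phi>) = All (lift_fm (Suc k) \<phi>)"
| "lift_fm k (Ex \<phi>) = Ex (lift_fm (Suc k) \<phi>)"

text \<open>\<open>subst_fm k t \<phi>\<close> replaces variable \<open>k\<close> by \<open>t\<close> and decrements the variables above \<open>k\<close>.\<close>

fun subst_tm :: "nat \<Rightarrow> tm \<Rightarrow> tm \<Rightarrow> tm" where
  "subst_tm k u (Var i) = (if i < k then Var i else if i = k then u else Var (i - 1))"
| "subst_tm k u Zero = Zero"
| "subst_tm k u (Succ t) = Succ (subst_tm k u t)"
| "subst_tm k u (Plus s t) = Plus (subst_tm k u s) (subst_tm k u t)"
| "subst_tm k u (Times s t) = Times (subst_tm k u s) (subst_tm k u t)"
| "subst_tm k u (Expt s t) = Expt (subst_tm k u s) (subst_tm k u t)"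

fun subst_fm :: "nat \<Rightarrow> tm \<Rightarrow> fm \<Rightarrow> fm" where
  "subst_fm k u (Eq s t) = Eq (subst_tm k u s) (subst_tm k u t)"
| "subst_fm k u (Less s t) = Less (subst_tm k u s) (subst_tm k u t)"
| "subst_fm k u (Neg \<phi>) = Neg (subst_fm k u \<phi>)"
| "subst_fm k u (And \<phi> \<psi>) = And (subst_fm k u \<phi>) (subst_fm k u \<psi>)"
| "subst_fm k u (Or \<phi> \<psi>) = Or (subst_fm k u \<phi>) (subst_fm k u \<psi>)"
| "subst_fm k u (Imp \<phi> \<psi>) = Imp (subst_fm k u \<phi>) (subst_fm k u \<psi>)"
| "subst_fm k u (All \<phi>) = All (subst_fm (Suc k) (lift_tm 0 u) \<phi>)"
| "subst_fm k u (Ex \<phi>) = Ex (subst_fm (Suc k) (lift_tm 0 u) \<phi>)"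

section \<open>Peano arithmetic\<close>

text \<open>A Hilbert calculus for classical first-order logic with equality; the rules (modus ponens
  and generalization) are in \<open>PA_proves\<close> below. Provability of a formula with free variables
  thus means provability of its universal closure.\<close>

inductive logical_axiom :: "fm \<Rightarrow> bool" where
  K: "logical_axiom (Imp \<phi> (Imp \<psi> \<phi>))"
| S: "logical_axiom (Imp (Imp \<phi> (Imp \<psi> \<chi>)) (Imp (Imp \<phi> \<psi>) (Imp \<phi> \<chi>)))"
| Contrapos: "logical_axiom (Imp (Imp (Neg \<phi>) (Neg \<psi>)) (Imp \<psi> \<phi>))"
| AndE1: "logical_axiom (Imp (And \<phi> \<psi>) \<phi>)"
| AndE2: "logical_axiom (Imp (And \<phi> \<psi>) \<psi>)"
| AndI: "logical_axiom (Imp \<phi> (Imp \<psi> (And \<phi> \<psi>)))"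
| OrI1: "logical_axiom (Imp \<phi> (Or \<phi> \<psi>))"
| OrI2: "logical_axiom (Imp \<psi> (Or \<phi> \<psi>))"
| OrE: "logical_axiom (Imp (Imp \<phi> \<chi>) (Imp (Imp \<psi> \<chi>) (Imp (Or \<phi> \<psi>) \<chi>)))"
| AllE: "logical_axiom (Imp (All \<phi>) (subst_fm 0 t \<phi>))"
| AllI: "logical_axiom (Imp (All (Imp (lift_fm 0 \<psi>) \<phi>)) (Imp \<psi> (All \<phi>)))"
| ExI: "logical_axiom (Imp (subst_fm 0 t \<phi>) (Ex \<phi>))"
| ExE: "logical_axiom (Imp (All (Imp \<phi> (lift_fm 0 \<psi>))) (Imp (Ex \<phi>) \<psi>))"
| Refl: "logical_axiom (Eq t t)"
| Leibniz: "logical_axiom (Imp (Eq s t) (Imp (subst_fm 0 s \<phi>) (subst_fm 0 t \<phi>)))"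

text \<open>Free variables in the axioms are understood universally. In the induction schema,
  \<open>subst_fm 0 (Succ (Var 0)) (lift_fm 1 \<phi>)\<close> is \<open>\<phi>\<close> with its variable \<open>0\<close> replaced by its
  successor and the parameters unchanged.\<close>

inductive PA_axiom :: "fm \<Rightarrow> bool" where
  Succ_nonzero: "PA_axiom (Neg (Eq (Succ (Var 0)) Zero))"
| Succ_inj: "PA_axiom (Imp (Eq (Succ (Var 0)) (Succ (Var 1))) (Eq (Var 0) (Var 1)))"
| Plus_Zero: "PA_axiom (Eq (Plus (Var 0) Zero) (Var 0))"
| Plus_Succ: "PA_axiom (Eq (Plus (Var 0) (Succ (Var 1))) (Succ (Plus (Var 0) (Var 1))))"
| Times_Zero: "PA_axiom (Eq (Times (Var 0) Zero) Zero)"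
| Times_Succ:
    "PA_axiom (Eq (Times (Var 0) (Succ (Var 1))) (Plus (Times (Var 0) (Var 1)) (Var 0)))"
| Expt_Zero: "PA_axiom (Eq (Expt (Var 0) Zero) (Succ Zero))"
| Expt_Succ:
    "PA_axiom (Eq (Expt (Var 0) (Succ (Var 1))) (Times (Expt (Var 0) (Var 1)) (Var 0)))"
| Less_Zero: "PA_axiom (Neg (Less (Var 0) Zero))"
| Less_Succ:
    "PA_axiom (Iff (Less (Var 0) (Succ (Var 1))) (Or (Less (Var 0) (Var 1)) (Eq (Var 0) (Var 1))))"
| Induction:
    "PA_axiom (Imp (And (subst_fm 0 Zero \<phi>)
                        (All (Imp \<phi> (subst_fm 0 (Succ (Var 0)) (lift_fm 1 \<phi>)))))
                   (All \<phi>))"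

inductive PA_proves :: "fm \<Rightarrow> bool" where
  Logic: "logical_axiom \<phi> \<Longrightarrow> PA_proves \<phi>"
| Axiom: "PA_axiom \<phi> \<Longrightarrow> PA_proves \<phi>"
| MP: "PA_proves (Imp \<phi> \<psi>) \<Longrightarrow> PA_proves \<phi> \<Longrightarrow> PA_proves \<psi>"
| Gen: "PA_proves \<phi> \<Longrightarrow> PA_proves (All \<phi>)"

section \<open>Deductively closed probability functions\<close>

definition ded_closed_prob :: "(fm \<Rightarrow> real) \<Rightarrow> bool" where
  "ded_closed_prob P \<longleftrightarrow>
     (\<forall>\<phi>\<in>sentences. 0 \<le> P \<phi> \<and> P \<phi> \<le> 1) \<and>
     (\<forall>\<phi>\<in>sentences. PA_proves \<phi> \<longrightarrow> P \<phi> = 1) \<and>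
     (\<forall>\<phi>\<in>sentences. \<forall>\<psi>\<in>sentences.
        PA_proves (Neg (And \<phi> \<psi>)) \<longrightarrow> P (Or \<phi> \<psi>) = P \<phi> + P \<psi>)"

section \<open>The arithmetical hierarchy\<close>

text \<open>The bounding term is lifted, so the quantified variable does not occur in it.\<close>

inductive bounded_fm :: "fm \<Rightarrow> bool" where
  "bounded_fm (Eq s t)"
| "bounded_fm (Less s t)"
| "bounded_fm \<phi> \<Longrightarrow> bounded_fm (Neg \<phi>)"
| "bounded_fm \<phi> \<Longrightarrow> bounded_fm \<psi> \<Longrightarrow> bounded_fm (And \<phi> \<psi>)"
| "bounded_fm \<phi> \<Longrightarrow> bounded_fm \<psi> \<Longrightarrow> bounded_fm (Or \<phi> \<psi>)"
| "bounded_fm \<phi> \<Longrightarrow> bounded_fm \<psi> \<Longrightarrow> bounded_fm (Imp \<phi> \<psi>)"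
| "bounded_fm \<phi> \<Longrightarrow> bounded_fm (All (Imp (Less (Var 0) (lift_tm 0 t)) \<phi>))"
| "bounded_fm \<phi> \<Longrightarrow> bounded_fm (Ex (And (Less (Var 0) (lift_tm 0 t)) \<phi>))"

fun Sigma_fm :: "nat \<Rightarrow> fm \<Rightarrow> bool" and Pi_fm :: "nat \<Rightarrow> fm \<Rightarrow> bool" where
  "Sigma_fm 0 \<phi> \<longleftrightarrow> bounded_fm \<phi>"
| "Sigma_fm (Suc n) \<phi> \<longleftrightarrow> (\<exists>m \<psi>. \<phi> = (Ex ^^ m) \<psi> \<and> Pi_fm n \<psi>)"
| "Pi_fm 0 \<phi> \<longleftrightarrow> bounded_fm \<phi>"
| "Pi_fm (Suc n) \<phi> \<longleftrightarrow> (\<exists>m \<psi>. \<phi> = (All ^^ m) \<psi> \<and> Sigma_fm n \<psi>)"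

fun Delta_fm :: "nat \<Rightarrow> fm \<Rightarrow> bool" where
  "Delta_fm 0 \<phi> \<longleftrightarrow> bounded_fm \<phi>"
| "Delta_fm (Suc n) \<phi> \<longleftrightarrow>
     (\<exists>\<sigma>. Sigma_fm (Suc n) \<sigma> \<and> PA_proves (Iff \<phi> \<sigma>)) \<and>
     (\<exists>\<pi>. Pi_fm (Suc n) \<pi> \<and> PA_proves (Iff \<phi> \<pi>))"

section \<open>Coding\<close>

fun tm_code :: "tm \<Rightarrow> nat" where
  "tm_code (Var i) = prod_encode (0, i)"
| "tm_code Zero = prod_encode (1, 0)"
| "tm_code (Succ t) = prod_encode (2, tm_code t)"
| "tm_code (Plus s t) = prod_encode (3, prod_encode (tm_code s, tm_code t))"
| "tm_code (Times s t) = prod_encode (4, prod_encode (tm_code s, tm_code t))"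
| "tm_code (Expt s t) = prod_encode (5, prod_encode (tm_code s, tm_code t))"

fun fm_code :: "fm \<Rightarrow> nat" where
  "fm_code (Eq s t) = prod_encode (0, prod_encode (tm_code s, tm_code t))"
| "fm_code (Less s t) = prod_encode (1, prod_encode (tm_code s, tm_code t))"
| "fm_code (Neg \<phi>) = prod_encode (2, fm_code \<phi>)"
| "fm_code (And \<phi> \<psi>) = prod_encode (3, prod_encode (fm_code \<phi>, fm_code \<psi>))"
| "fm_code (Or \<phi> \<psi>) = prod_encode (4, prod_encode (fm_code \<phi>, fm_code \<psi>))"
| "fm_code (Imp \<phi> \<psi>) = prod_encode (5, prod_encode (fm_code \<phi>, fm_code \<psi>))"
| "fm_code (All \<phi>) = prod_encode (6, fm_code \<phi>)"
| "fm_code (Ex \<phi>) = prod_encode (7, fm_code \<phi>)"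

lemma inj_tm_code: "inj tm_code"
proof -
  have "tm_code s = tm_code t \<Longrightarrow> s = t" for s t
    by (induction s arbitrary: t; case_tac t) (simp_all add: prod_encode_eq)
  then show ?thesis by (auto intro: injI)
qed

lemma inj_fm_code: "inj fm_code"
proof -
  have "fm_code \<phi> = fm_code \<psi> \<Longrightarrow> \<phi> = \<psi>" for \<phi> \<psi>
    by (induction \<phi> arbitrary: \<psi>; case_tac \<psi>)
      (auto simp: prod_encode_eq inj_eq[OF inj_tm_code])
  then show ?thesis by (auto intro: injI)
qed

text \<open>Rationals are coded by their normalized fractions.\<close>

definition rat_code :: "rat \<Rightarrow> nat" where
  "rat_code q = (case quotient_of q of (a, b) \<Rightarrow> prod_encode (int_encode a, nat b))"

section \<open>Definability\<close>

text \<open>\<open>Ex1 \<phi>\<close> is \<open>\<exists>y. \<forall>z. \<phi>(z) \<longleftrightarrow> z = y\<close>, where \<open>\<phi>\<close> has the variable \<open>0\<close> bound.\<close>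

definition Ex1 :: "fm \<Rightarrow> fm" where
  "Ex1 \<phi> = Ex (All (Iff (lift_fm 1 \<phi>) (Eq (Var 0) (Var 1))))"

text \<open>A domain \<open>D\<close> of \<open>k\<close>-tuples enters provability in PA through a formula \<open>\<delta>\<close> expressing
  membership in \<open>D\<close>, with \<open>x\<^sub>1, \<dots>, x\<^sub>k\<close> as variables \<open>0, \<dots>, k - 1\<close>.\<close>

definition defines_set :: "nat \<Rightarrow> fm \<Rightarrow> nat list set \<Rightarrow> bool" where
  "defines_set k \<delta> D \<longleftrightarrow>
     fm_below k \<delta> \<and> D = {xs. length xs = k \<and> holds \<delta> xs}"

text \<open>In \<open>\<phi>(x\<^sub>1, \<dots>, x\<^sub>k, y)\<close> the value \<open>y\<close> is variable \<open>0\<close> and the arguments are variables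
  \<open>1, \<dots>, k\<close>.\<close>

definition defines_rat_fun ::
  "nat \<Rightarrow> fm \<Rightarrow> nat list set \<Rightarrow> fm \<Rightarrow> (nat list \<Rightarrow> rat) \<Rightarrow> bool" where
  "defines_rat_fun k \<delta> D \<phi> g \<longleftrightarrow>
     defines_set k \<delta> D \<and> fm_below (Suc k) \<phi> \<and>
     (\<forall>xs\<in>D. \<forall>q. g xs = q \<longleftrightarrow> holds \<phi> (rat_code q # xs)) \<and>
     PA_proves ((All ^^ k) (Imp \<delta> (Ex1 \<phi>)))"

definition times_omega :: "nat list set \<Rightarrow> nat list set" where
  "times_omega D = {xs @ [n] | xs n. xs \<in> D}"

definition approximates :: "nat list set \<Rightarrow> (nat list \<Rightarrow> rat) \<Rightarrow> (nat list \<Rightarrow> real) \<Rightarrow> bool" where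
  "approximates D g f \<longleftrightarrow> (\<forall>xs\<in>D. \<forall>n. \<bar>f xs - real_of_rat (g (xs @ [n]))\<bar> \<le> 1 / 2 ^ n)"

text \<open>\<open>definable C k \<delta> D f\<close>: the function \<open>f\<close> with domain \<open>D\<close>, a set of \<open>k\<close>-tuples expressed
  by \<open>\<delta>\<close>, has an approximation defined by a formula in the class \<open>C\<close>. As \<open>n\<close> is the last
  argument of the approximation, \<open>\<delta>\<close> also expresses the domain \<open>D \<times> \<omega>\<close>.\<close>

definition definable ::
  "(fm \<Rightarrow> bool) \<Rightarrow> nat \<Rightarrow> fm \<Rightarrow> nat list set \<Rightarrow> (nat list \<Rightarrow> real) \<Rightarrow> bool" where
  "definable C k \<delta> D f \<longleftrightarrow> defines_set k \<delta> D \<and>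
     (\<exists>g \<phi>. approximates D g f \<and> C \<phi> \<and> defines_rat_fun (Suc k) \<delta> (times_omega D) \<phi> g)"

section \<open>The arithmetical formula for ``being the code of a sentence''\<close>

abbreviation up :: "tm \<Rightarrow> tm" where "up \<equiv> lift_tm 0"

abbreviation num :: "nat \<Rightarrow> tm" where "num n \<equiv> (Succ ^^ n) Zero"

text \<open>\<open>p = prod_encode (a, b)\<close>, doubled to avoid division\<close>

definition Pair_fm :: "tm \<Rightarrow> tm \<Rightarrow> tm \<Rightarrow> fm" where
  "Pair_fm a b p =
     Eq (Plus p p) (Plus (Times (Plus a b) (Succ (Plus a b))) (Plus a a))"

text \<open>\<open>e \<in> set_decode w\<close>, that is, the binary digit of \<open>w\<close> at position \<open>e\<close> is 1\<close>

definition Mem_fm :: "tm \<Rightarrow> tm \<Rightarrow> fm" where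
  "Mem_fm e w = (let e' = up (up e); b = Expt (num 2) e' in
     Ex (Ex (And (Less (Var 0) b)
       (Eq (up (up w)) (Plus (Times (Var 1) (Expt (num 2) (Succ e'))) (Plus b (Var 0)))))))"

definition PMem_fm :: "tm \<Rightarrow> tm \<Rightarrow> tm \<Rightarrow> fm" where
  "PMem_fm d c w = Ex (And (Pair_fm (up d) (up c) (Var 0)) (Mem_fm (Var 0) (up w)))"

definition Unary_fm :: "nat \<Rightarrow> tm \<Rightarrow> tm \<Rightarrow> tm \<Rightarrow> fm" where
  "Unary_fm k d c w =
     Ex (And (Pair_fm (num k) (Var 0) (up c)) (PMem_fm (up d) (Var 0) (up w)))"

definition Binary_fm :: "nat \<Rightarrow> tm \<Rightarrow> tm \<Rightarrow> tm \<Rightarrow> fm" where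
  "Binary_fm k d c w = (let d' = up (up (up d)); c' = up (up (up c)); w' = up (up (up w)) in
     Ex (Ex (Ex (And (And (Pair_fm (Var 2) (Var 1) (Var 0)) (Pair_fm (num k) (Var 0) c'))
                     (And (PMem_fm d' (Var 2) w') (PMem_fm d' (Var 1) w'))))))"

text \<open>The sets coded by \<open>u\<close> and \<open>w\<close> certify \<open>tm_below\<close> and \<open>fm_below\<close>: if \<open>u\<close> contains the pair
  of \<open>d\<close> and \<open>c\<close>, then \<open>c\<close> is the code of a term with variables below \<open>d\<close>, and similarly for
  \<open>w\<close> and formulas.\<close>

definition Tm_step_fm :: "tm \<Rightarrow> tm \<Rightarrow> tm \<Rightarrow> fm" where
  "Tm_step_fm d c u =
     Or (Ex (And (Less (Var 0) (up d)) (Pair_fm (num 0) (Var 0) (up c))))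
    (Or (Pair_fm (num 1) (num 0) c)
    (Or (Unary_fm 2 d c u)
    (Or (Binary_fm 3 d c u)
    (Or (Binary_fm 4 d c u)
        (Binary_fm 5 d c u)))))"

definition Fm_step_fm :: "tm \<Rightarrow> tm \<Rightarrow> tm \<Rightarrow> tm \<Rightarrow> fm" where
  "Fm_step_fm d c u w =
     Or (Binary_fm 0 d c u)
    (Or (Binary_fm 1 d c u)
    (Or (Unary_fm 2 d c w)
    (Or (Binary_fm 3 d c w)
    (Or (Binary_fm 4 d c w)
    (Or (Binary_fm 5 d c w)
    (Or (Unary_fm 6 (Succ d) c w)
        (Unary_fm 7 (Succ d) c w)))))))"

definition Sent_fm :: fm where
  "Sent_fm =
     Ex (Ex (And (PMem_fm Zero (Var 2) (Var 0))
       (All (All (And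
         (Imp (PMem_fm (Var 1) (Var 0) (Var 3)) (Tm_step_fm (Var 1) (Var 0) (Var 3)))
         (Imp (PMem_fm (Var 1) (Var 0) (Var 2)) (Fm_step_fm (Var 1) (Var 0) (Var 3) (Var 2))))))))"

definition sentence_codes :: "nat list set" where
  "sentence_codes = {[fm_code \<phi>] | \<phi>. \<phi> \<in> sentences}"

lemma eval_lift_0 [simp]: "eval (case_nat a e) (up t) = eval e t"
  by (induction t) auto

lemma eval_num [simp]: "eval e (num n) = n"
  by (induction n) auto

lemma sat_Pair_fm: "sat e (Pair_fm a b p) \<longleftrightarrow> eval e p = prod_encode (eval e a, eval e b)"
proof -
  have *: "2 * triangle n = n * Suc n" for n
    by (simp add: triangle_def)
  show ?thesis
    using *[of "eval e a + eval e b"] unfolding Pair_fm_def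
    by (simp add: prod_encode_def del: mult_Suc_right) linarith
qed

lemma odd_div_power_iff:
  "odd (w div 2 ^ e) \<longleftrightarrow> (\<exists>q r. r < 2 ^ e \<and> w = q * 2 ^ Suc e + (2 ^ e + r))" for w e :: nat
proof
  assume "odd (w div 2 ^ e)"
  then obtain q where q: "w div 2 ^ e = 2 * q + 1" by (auto elim: oddE)
  have "w = (2 * q + 1) * 2 ^ e + w mod 2 ^ e"
    using div_mult_mod_eq[of w "2 ^ e"] q by simp
  then have "w = q * 2 ^ Suc e + (2 ^ e + w mod 2 ^ e)" by (simp add: algebra_simps)
  moreover have "w mod 2 ^ e < 2 ^ e" by simp
  ultimately show "\<exists>q r. r < 2 ^ e \<and> w = q * 2 ^ Suc e + (2 ^ e + r)" by blast
next
  assume "\<exists>q r. r < 2 ^ e \<and> w = q * 2 ^ Suc e + (2 ^ e + r)"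
  then obtain q r where r: "r < 2 ^ e" and w: "w = (2 * q + 1) * 2 ^ e + r"
    by (auto simp: algebra_simps)
  have "w div 2 ^ e = 2 * q + 1"
    unfolding w using r by (subst div_mult_self3) auto
  then show "odd (w div 2 ^ e)" by simp
qed

lemma sat_Mem_fm: "sat e (Mem_fm t w) \<longleftrightarrow> eval e t \<in> set_decode (eval e w)"
  unfolding Mem_fm_def set_decode_def mem_Collect_eq odd_div_power_iff
  by (simp add: Let_def numeral_2_eq_2)

lemma sat_PMem_fm:
  "sat e (PMem_fm d c w) \<longleftrightarrow> prod_encode (eval e d, eval e c) \<in> set_decode (eval e w)"
  by (simp add: PMem_fm_def sat_Pair_fm sat_Mem_fm)

lemma sat_Unary_fm:
  "sat e (Unary_fm k d c w) \<longleftrightarrow> (\<exists>a. eval e c = prod_encode (k, a) \<and>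
     prod_encode (eval e d, a) \<in> set_decode (eval e w))"
  by (simp add: Unary_fm_def sat_Pair_fm sat_PMem_fm)

lemma sat_Binary_fm:
  "sat e (Binary_fm k d c w) \<longleftrightarrow> (\<exists>a b. eval e c = prod_encode (k, prod_encode (a, b)) \<and>
     prod_encode (eval e d, a) \<in> set_decode (eval e w) \<and>
     prod_encode (eval e d, b) \<in> set_decode (eval e w))"
  by (simp add: Binary_fm_def Let_def sat_Pair_fm sat_PMem_fm)

lemma prod_encode_bounds:
  "0 < a \<Longrightarrow> b < prod_encode (a, b)" "a \<le> prod_encode (a, b)" "b \<le> prod_encode (a, b)"
proof -
  have "n \<le> triangle n" for n
    by (induction n) auto
  then have "a + b \<le> triangle (a + b)" .
  then show "0 < a \<Longrightarrow> b < prod_encode (a, b)" by (simp add: prod_encode_def)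
qed (rule le_prod_encode_1 le_prod_encode_2)+

lemma prod_encode_component_less:
  "0 < k \<Longrightarrow> a < prod_encode (k, prod_encode (a, b))"
  "0 < k \<Longrightarrow> b < prod_encode (k, prod_encode (a, b))"
  using prod_encode_bounds(1)[of k "prod_encode (a, b)"] prod_encode_bounds(2,3)[where a = a and b = b]
  by simp_all

definition tm_step :: "nat set \<Rightarrow> nat \<Rightarrow> nat \<Rightarrow> bool" where
  "tm_step U d c \<longleftrightarrow>
     (\<exists>i<d. c = prod_encode (0, i)) \<or> c = prod_encode (1, 0) \<or>
     (\<exists>a. c = prod_encode (2, a) \<and> prod_encode (d, a) \<in> U) \<or>
     (\<exists>k\<in>{3, 4, 5}. \<exists>a b. c = prod_encode (k, prod_encode (a, b)) \<and>
        prod_encode (d, a) \<in> U \<and> prod_encode (d, b) \<in> U)"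

definition fm_step :: "nat set \<Rightarrow> nat set \<Rightarrow> nat \<Rightarrow> nat \<Rightarrow> bool" where
  "fm_step U W d c \<longleftrightarrow>
     (\<exists>k\<in>{0, 1}. \<exists>a b. c = prod_encode (k, prod_encode (a, b)) \<and>
        prod_encode (d, a) \<in> U \<and> prod_encode (d, b) \<in> U) \<or>
     (\<exists>a. c = prod_encode (2, a) \<and> prod_encode (d, a) \<in> W) \<or>
     (\<exists>k\<in>{3, 4, 5}. \<exists>a b. c = prod_encode (k, prod_encode (a, b)) \<and>
        prod_encode (d, a) \<in> W \<and> prod_encode (d, b) \<in> W) \<or>
     (\<exists>k\<in>{6, 7}. \<exists>a. c = prod_encode (k, a) \<and> prod_encode (Suc d, a) \<in> W)"

lemma sat_Tm_step_fm:
  "sat e (Tm_step_fm d c u) \<longleftrightarrow> tm_step (set_decode (eval e u)) (eval e d) (eval e c)"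
  by (simp add: Tm_step_fm_def tm_step_def sat_Pair_fm sat_Unary_fm sat_Binary_fm)

lemma sat_Fm_step_fm:
  "sat e (Fm_step_fm d c u w) \<longleftrightarrow>
     fm_step (set_decode (eval e u)) (set_decode (eval e w)) (eval e d) (eval e c)"
  by (simp add: Fm_step_fm_def fm_step_def sat_Unary_fm sat_Binary_fm)

lemma sat_Sent_fm:
  "sat e Sent_fm \<longleftrightarrow> (\<exists>u w. prod_encode (0, e 0) \<in> set_decode w \<and>
     (\<forall>d c. (prod_encode (d, c) \<in> set_decode u \<longrightarrow> tm_step (set_decode u) d c) \<and>
            (prod_encode (d, c) \<in> set_decode w \<longrightarrow> fm_step (set_decode u) (set_decode w) d c)))"
  by (simp add: Sent_fm_def sat_PMem_fm sat_Tm_step_fm sat_Fm_step_fm numeral_2_eq_2 numeral_3_eq_3)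

lemma tm_certificate:
  assumes "\<And>d c. prod_encode (d, c) \<in> U \<Longrightarrow> tm_step U d c" "prod_encode (d, c) \<in> U"
  shows "\<exists>t. tm_below d t \<and> c = tm_code t"
  using assms(2)
proof (induction c arbitrary: d rule: less_induct)
  case (less c)
  consider (var) i where "i < d" "c = prod_encode (0, i)" | (zero) "c = prod_encode (1, 0)"
    | (succ) a where "c = prod_encode (2, a)" "prod_encode (d, a) \<in> U"
    | (bin) k a b where "k \<in> {3, 4, 5}" "c = prod_encode (k, prod_encode (a, b))"
        "prod_encode (d, a) \<in> U" "prod_encode (d, b) \<in> U"
    using assms(1)[OF less.prems] unfolding tm_step_def by (elim disjE exE bexE conjE) (rule that; assumption)+
  then show ?case
  proof cases
    case var
    then show ?thesis by (intro exI[of _ "Var i"]) simp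
  next
    case zero
    then show ?thesis by (intro exI[of _ Zero]) simp
  next
    case succ
    then obtain t where "tm_below d t" "a = tm_code t"
      using less.IH[of a d] prod_encode_bounds(1)[of 2 a] by auto
    with succ show ?thesis by (intro exI[of _ "Succ t"]) simp
  next
    case bin
    then have "a < c" "b < c" using prod_encode_component_less[of k] by auto
    then obtain s t where st: "tm_below d s" "a = tm_code s" "tm_below d t" "b = tm_code t"
      using less.IH[of a d] less.IH[of b d] bin by blast
    have "c \<in> tm_code ` {Plus s t, Times s t, Expt s t}" using bin st by auto
    moreover have "\<forall>t'\<in>{Plus s t, Times s t, Expt s t}. tm_below d t'" using st by simp
    ultimately show ?thesis by (metis imageE)
  qed
qed

lemma fm_certificate:
  assumes "\<And>d c. prod_encode (d, c) \<in> U \<Longrightarrow> tm_step U d c"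
    and "\<And>d c. prod_encode (d, c) \<in> W \<Longrightarrow> fm_step U W d c" "prod_encode (d, c) \<in> W"
  shows "\<exists>\<phi>. fm_below d \<phi> \<and> c = fm_code \<phi>"
  using assms(3)
proof (induction c arbitrary: d rule: less_induct)
  case (less c)
  consider (atom) k a b where "k \<in> {0, 1}" "c = prod_encode (k, prod_encode (a, b))"
        "prod_encode (d, a) \<in> U" "prod_encode (d, b) \<in> U"
    | (neg) a where "c = prod_encode (2, a)" "prod_encode (d, a) \<in> W"
    | (bin) k a b where "k \<in> {3, 4, 5}" "c = prod_encode (k, prod_encode (a, b))"
        "prod_encode (d, a) \<in> W" "prod_encode (d, b) \<in> W"
    | (quant) k a where "k \<in> {6, 7}" "c = prod_encode (k, a)" "prod_encode (Suc d, a) \<in> W"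
    using assms(2)[OF less.prems] unfolding fm_step_def by (elim disjE exE bexE conjE) (rule that; assumption)+
  then show ?case
  proof cases
    case atom
    then obtain s t where st: "tm_below d s" "a = tm_code s" "tm_below d t" "b = tm_code t"
      using tm_certificate[OF assms(1)] by metis
    have "c \<in> fm_code ` {Eq s t, Less s t}" using atom st by auto
    moreover have "\<forall>\<phi>'\<in>{Eq s t, Less s t}. fm_below d \<phi>'" using st by simp
    ultimately show ?thesis by (metis imageE)
  next
    case neg
    then obtain \<phi> where "fm_below d \<phi>" "a = fm_code \<phi>"
      using less.IH[of a d] prod_encode_bounds(1)[of 2 a] by auto
    with neg show ?thesis by (intro exI[of _ "Neg \<phi>"]) simp
  next
    case bin
    then have "a < c" "b < c" using prod_encode_component_less[of k] by auto
    then obtain \<phi> \<psi> where st: "fm_below d \<phi>" "a = fm_code \<phi>" "fm_below d \<psi>" "b = fm_code \<psi>"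
      using less.IH[of a d] less.IH[of b d] bin by blast
    have "c \<in> fm_code ` {And \<phi> \<psi>, Or \<phi> \<psi>, Imp \<phi> \<psi>}" using bin st by auto
    moreover have "\<forall>\<phi>'\<in>{And \<phi> \<psi>, Or \<phi> \<psi>, Imp \<phi> \<psi>}. fm_below d \<phi>'" using st by simp
    ultimately show ?thesis by (metis imageE)
  next
    case quant
    then have "a < c" using prod_encode_bounds(1)[of k a] by auto
    then obtain \<phi> where st: "fm_below (Suc d) \<phi>" "a = fm_code \<phi>"
      using less.IH[of a "Suc d"] quant by blast
    have "c \<in> fm_code ` {All \<phi>, Ex \<phi>}" using quant st by auto
    moreover have "\<forall>\<phi>'\<in>{All \<phi>, Ex \<phi>}. fm_below d \<phi>'" using st by simp
    ultimately show ?thesis by (metis imageE)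
  qed
qed

definition tm_pairs :: "nat \<Rightarrow> nat set" where
  "tm_pairs N = {prod_encode (d, tm_code t) | d t. d + tm_code t \<le> N \<and> tm_below d t}"

definition fm_pairs :: "nat \<Rightarrow> nat set" where
  "fm_pairs N = {prod_encode (d, fm_code \<phi>) | d \<phi>. d + fm_code \<phi> \<le> N \<and> fm_below d \<phi>}"

lemma finite_pairs: "finite (tm_pairs N)" "finite (fm_pairs N)"
proof -
  have "tm_pairs N \<subseteq> prod_encode ` ({..N} \<times> {..N})" "fm_pairs N \<subseteq> prod_encode ` ({..N} \<times> {..N})"
    by (auto simp: tm_pairs_def fm_pairs_def)
  then show "finite (tm_pairs N)" "finite (fm_pairs N)"
    by (auto elim: finite_subset)
qed

lemma tm_pairs_iff: "prod_encode (d, tm_code t) \<in> tm_pairs N \<longleftrightarrow> d + tm_code t \<le> N \<and> tm_below d t"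
  by (auto simp: tm_pairs_def prod_encode_eq inj_eq[OF inj_tm_code])

lemma fm_pairs_iff: "prod_encode (d, fm_code \<phi>) \<in> fm_pairs N \<longleftrightarrow> d + fm_code \<phi> \<le> N \<and> fm_below d \<phi>"
  by (auto simp: fm_pairs_def prod_encode_eq inj_eq[OF inj_fm_code])

lemma le_prod_encode_components:
  "d + prod_encode (k, a) \<le> N \<Longrightarrow> d + a \<le> N"
  "d + prod_encode (k, prod_encode (a, b)) \<le> N \<Longrightarrow> d + a \<le> N"
  "d + prod_encode (k, prod_encode (a, b)) \<le> N \<Longrightarrow> d + b \<le> N"
  "0 < k \<Longrightarrow> d + prod_encode (k, a) \<le> N \<Longrightarrow> Suc d + a \<le> N"
  using prod_encode_bounds(3)[of a k] prod_encode_bounds(3)[of "prod_encode (a, b)" k]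
    prod_encode_bounds(2,3)[where a = a and b = b] prod_encode_bounds(1)[of k a]
  by linarith+

lemma tm_step_tm_code:
  assumes "tm_below d t" "d + tm_code t \<le> N"
  shows "tm_step (tm_pairs N) d (tm_code t)"
proof (cases t)
  case (Var i)
  with assms show ?thesis by (auto simp: tm_step_def)
next
  case Zero
  then show ?thesis by (simp add: tm_step_def)
next
  case (Succ a)
  then have "prod_encode (d, tm_code a) \<in> tm_pairs N"
    using assms le_prod_encode_components(1)[of d 2 "tm_code a" N] by (simp add: tm_pairs_iff)
  then show ?thesis unfolding tm_step_def Succ tm_code.simps by blast
next
  case (Plus a b)
  then have "prod_encode (d, tm_code a) \<in> tm_pairs N" "prod_encode (d, tm_code b) \<in> tm_pairs N"
    using assms le_prod_encode_components(2,3)[of d 3 "tm_code a" "tm_code b" N]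
    by (simp_all add: tm_pairs_iff)
  then show ?thesis unfolding tm_step_def Plus tm_code.simps by blast
next
  case (Times a b)
  then have "prod_encode (d, tm_code a) \<in> tm_pairs N" "prod_encode (d, tm_code b) \<in> tm_pairs N"
    using assms le_prod_encode_components(2,3)[of d 4 "tm_code a" "tm_code b" N]
    by (simp_all add: tm_pairs_iff)
  then show ?thesis unfolding tm_step_def Times tm_code.simps by blast
next
  case (Expt a b)
  then have "prod_encode (d, tm_code a) \<in> tm_pairs N" "prod_encode (d, tm_code b) \<in> tm_pairs N"
    using assms le_prod_encode_components(2,3)[of d 5 "tm_code a" "tm_code b" N]
    by (simp_all add: tm_pairs_iff)
  then show ?thesis unfolding tm_step_def Expt tm_code.simps by blast
qed

lemma fm_step_fm_code:
  assumes "fm_below d \<phi>" "d + fm_code \<phi> \<le> N"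
  shows "fm_step (tm_pairs N) (fm_pairs N) d (fm_code \<phi>)"
proof (cases \<phi>)
  case (Eq a b)
  then have "prod_encode (d, tm_code a) \<in> tm_pairs N" "prod_encode (d, tm_code b) \<in> tm_pairs N"
    using assms le_prod_encode_components(2,3)[of d 0 "tm_code a" "tm_code b" N]
    by (simp_all add: tm_pairs_iff)
  then show ?thesis unfolding fm_step_def Eq fm_code.simps by blast
next
  case (Less a b)
  then have "prod_encode (d, tm_code a) \<in> tm_pairs N" "prod_encode (d, tm_code b) \<in> tm_pairs N"
    using assms le_prod_encode_components(2,3)[of d 1 "tm_code a" "tm_code b" N]
    by (simp_all add: tm_pairs_iff)
  then show ?thesis unfolding fm_step_def Less fm_code.simps by blast
next
  case (Neg a)
  then have "prod_encode (d, fm_code a) \<in> fm_pairs N"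
    using assms le_prod_encode_components(1)[of d 2 "fm_code a" N] by (simp add: fm_pairs_iff)
  then show ?thesis unfolding fm_step_def Neg fm_code.simps by blast
next
  case (And a b)
  then have "prod_encode (d, fm_code a) \<in> fm_pairs N" "prod_encode (d, fm_code b) \<in> fm_pairs N"
    using assms le_prod_encode_components(2,3)[of d 3 "fm_code a" "fm_code b" N]
    by (simp_all add: fm_pairs_iff)
  then show ?thesis unfolding fm_step_def And fm_code.simps by blast
next
  case (Or a b)
  then have "prod_encode (d, fm_code a) \<in> fm_pairs N" "prod_encode (d, fm_code b) \<in> fm_pairs N"
    using assms le_prod_encode_components(2,3)[of d 4 "fm_code a" "fm_code b" N]
    by (simp_all add: fm_pairs_iff)
  then show ?thesis unfolding fm_step_def Or fm_code.simps by blast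
next
  case (Imp a b)
  then have "prod_encode (d, fm_code a) \<in> fm_pairs N" "prod_encode (d, fm_code b) \<in> fm_pairs N"
    using assms le_prod_encode_components(2,3)[of d 5 "fm_code a" "fm_code b" N]
    by (simp_all add: fm_pairs_iff)
  then show ?thesis unfolding fm_step_def Imp fm_code.simps by blast
next
  case (All a)
  then have "prod_encode (Suc d, fm_code a) \<in> fm_pairs N"
    using assms le_prod_encode_components(4)[of 6 d "fm_code a" N] by (simp add: fm_pairs_iff)
  then show ?thesis unfolding fm_step_def All fm_code.simps by blast
next
  case (Ex a)
  then have "prod_encode (Suc d, fm_code a) \<in> fm_pairs N"
    using assms le_prod_encode_components(4)[of 7 d "fm_code a" N] by (simp add: fm_pairs_iff)
  then show ?thesis unfolding fm_step_def Ex fm_code.simps by blast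
qed

lemma sat_Sent_fm_iff: "sat e Sent_fm \<longleftrightarrow> e 0 \<in> fm_code ` sentences"
proof
  assume "sat e Sent_fm"
  then obtain u w where "prod_encode (0, e 0) \<in> set_decode w"
    "\<And>d c. prod_encode (d, c) \<in> set_decode u \<Longrightarrow> tm_step (set_decode u) d c"
    "\<And>d c. prod_encode (d, c) \<in> set_decode w \<Longrightarrow> fm_step (set_decode u) (set_decode w) d c"
    unfolding sat_Sent_fm by blast
  then show "e 0 \<in> fm_code ` sentences"
    using fm_certificate[of "set_decode u" "set_decode w" 0 "e 0"] by (auto simp: sentences_def)
next
  assume "e 0 \<in> fm_code ` sentences"
  then obtain \<phi> where \<phi>: "fm_below 0 \<phi>" "e 0 = fm_code \<phi>" by (auto simp: sentences_def)
  define U where "U = tm_pairs (e 0)"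
  define W where "W = fm_pairs (e 0)"
  have "prod_encode (0, e 0) \<in> W"
    using \<phi> by (simp add: W_def fm_pairs_iff)
  moreover have "tm_step U d c" if "prod_encode (d, c) \<in> U" for d c
    using that tm_step_tm_code unfolding U_def
    by (auto simp: tm_pairs_def prod_encode_eq)
  moreover have "fm_step U W d c" if "prod_encode (d, c) \<in> W" for d c
    using that fm_step_fm_code unfolding U_def W_def
    by (auto simp: fm_pairs_def prod_encode_eq)
  moreover have "set_decode (set_encode U) = U" "set_decode (set_encode W) = W"
    by (simp_all add: U_def W_def finite_pairs)
  ultimately show "sat e Sent_fm"
    unfolding sat_Sent_fm by metis
qed

text \<open>In the standard model, \<open>Sent_fm\<close> defines the set of codes of sentences.\<close>

lemma defines_set_Sent_fm: "defines_set 1 Sent_fm sentence_codes"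
proof -
  have "fm_below 1 Sent_fm"
    by (simp add: Sent_fm_def Tm_step_fm_def Fm_step_fm_def Unary_fm_def Binary_fm_def PMem_fm_def
        Mem_fm_def Pair_fm_def Let_def eval_nat_numeral)
  moreover have "sentence_codes = {xs. length xs = 1 \<and> holds Sent_fm xs}"
    by (auto simp: sentence_codes_def holds_def sat_Sent_fm_iff length_Suc_conv)
  ultimately show ?thesis by (simp add: defines_set_def)
qed

end

theory Submission
  imports Defs
begin

text \<open>The probability function is two-valued: it is the characteristic function of a complete
  extension \<open>T\<close> of \<open>PA\<close> that is computable from the halting problem. Completeness and consistency of
  \<open>T\<close> give both conditions on probability functions (\<open>completion_ded_closed_prob\<close>). The theory
  \<open>T\<close> has to be chosen in such a way that \<open>PA\<close> itself proves that its definition is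
  \<open>\<Delta>\<^sub>2\<close> and determines a unique value for every argument.

  The complete extensions of \<open>PA\<close> form a \<open>\<Pi>\<^sub>1\<close> class. They are obtained from the sets of numbers that
  satisfy a finite list of clauses of the form ``if these numbers belong to the set, then so does
  one of those''. The clauses speak about codes of formulas accepted as true and about auxiliary
  items recording substitutions and provable formulas, so the syntax and the proofs of \<open>PA\<close> are
  covered by the same closure conditions (\<open>proof_item\<close>). The formulas true in the standard model
  give one such set. The sets correspond to the paths through a binary tree, and \<open>T\<close> is read off
  from the leftmost path: its restriction to \<open>{0..c}\<close> is coded by the least number \<open>\<sigma>\<close> such that \<open>\<sigma>\<close> is extendible
  up to \<open>n\<close> for every \<open>n\<close>, and the leftmost path satisfies all clauses (\<open>path_satisfies\<close>). Extendibility
  up to \<open>n\<close> is expressed by a bounded formula (\<open>sat_tree_fm\<close>).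

  Thus membership of \<open>x\<close> in \<open>T\<close> is the parity of the least \<open>s\<close> with \<open>\<forall>w. R(w, s, x)\<close>, for a bounded formula
  \<open>R\<close>. That \<open>s\<close> is least can be written as \<open>\<forall>t<s. \<exists>w<b. \<not> R(w, t, x)\<close> together with
  \<open>\<forall>w. R(w, s, x)\<close>, for some bound \<open>b\<close>; quantifying \<open>s\<close> and \<open>b\<close> existentially or universally yields a
  \<open>\<Sigma>\<^sub>2\<close> and a \<open>\<Pi>\<^sub>2\<close> definition. In \<open>PA\<close> it has to be shown only that there is exactly one least
  \<open>s\<close> (\<open>PA_select_fm\<close>). This uses no property of \<open>R\<close> except that some \<open>s\<close> is a solution, and that is
  arranged by admitting \<open>2 ^ (c + 1)\<close> as a solution by definition (\<open>PA_tree_fm\<close>). So \<open>PA\<close> never has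
  to reason about syntax; the correctness of the coding is a fact about the standard model.

  The proofs in \<open>PA\<close> are carried out through a completeness theorem (\<open>henkin_completeness\<close>): a formula
  is provable if it belongs to every Henkin set, and membership in a Henkin set obeys Tarski's
  truth definition with the terms as elements.\<close>

section \<open>Simultaneous substitution\<close>

fun msub_tm :: "(nat \<Rightarrow> tm) \<Rightarrow> tm \<Rightarrow> tm" where
  "msub_tm s (Var i) = s i"
| "msub_tm s Zero = Zero"
| "msub_tm s (Succ t) = Succ (msub_tm s t)"
| "msub_tm s (Plus t u) = Plus (msub_tm s t) (msub_tm s u)"
| "msub_tm s (Times t u) = Times (msub_tm s t) (msub_tm s u)"
| "msub_tm s (Expt t u) = Expt (msub_tm s t) (msub_tm s u)"

text \<open>The form that a substitution takes below a quantifier.\<close>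

definition under :: "(nat \<Rightarrow> tm) \<Rightarrow> nat \<Rightarrow> tm" where
  "under s = case_nat (Var 0) (\<lambda>i. up (s i))"

fun msub :: "(nat \<Rightarrow> tm) \<Rightarrow> fm \<Rightarrow> fm" where
  "msub s (Eq t u) = Eq (msub_tm s t) (msub_tm s u)"
| "msub s (Less t u) = Less (msub_tm s t) (msub_tm s u)"
| "msub s (Neg \<phi>) = Neg (msub s \<phi>)"
| "msub s (And \<phi> \<psi>) = And (msub s \<phi>) (msub s \<psi>)"
| "msub s (Or \<phi> \<psi>) = Or (msub s \<phi>) (msub s \<psi>)"
| "msub s (Imp \<phi> \<psi>) = Imp (msub s \<phi>) (msub s \<psi>)"
| "msub s (All \<phi>) = All (msub (under s) \<phi>)"
| "msub s (Ex \<phi>) = Ex (msub (under s) \<phi>)"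

lemma lift_tm_eq_msub: "lift_tm k t = msub_tm (\<lambda>i. Var (if i < k then i else Suc i)) t"
  by (induction t) auto

lemma under_shift: "under (\<lambda>i. Var (if i < k then i else Suc i)) = (\<lambda>i. Var (if i < Suc k then i else Suc i))"
  by (auto simp: under_def fun_eq_iff split: nat.split)

lemma lift_fm_eq_msub: "lift_fm k \<phi> = msub (\<lambda>i. Var (if i < k then i else Suc i)) \<phi>"
  by (induction \<phi> arbitrary: k) (simp_all only: lift_fm.simps msub.simps lift_tm_eq_msub under_shift)

lemma subst_tm_eq_msub:
  "subst_tm k u t = msub_tm (\<lambda>i. if i < k then Var i else if i = k then u else Var (i - 1)) t"
  by (induction t) auto

lemma under_single:
  "under (\<lambda>i. if i < k then Var i else if i = k then u else Var (i - 1)) =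
     (\<lambda>i. if i < Suc k then Var i else if i = Suc k then up u else Var (i - 1))"
  by (auto simp: under_def fun_eq_iff split: nat.split)

lemma subst_fm_eq_msub:
  "subst_fm k u \<phi> = msub (\<lambda>i. if i < k then Var i else if i = k then u else Var (i - 1)) \<phi>"
  by (induction \<phi> arbitrary: k u)
    (simp_all only: subst_fm.simps msub.simps subst_tm_eq_msub under_single)

text \<open>Lifting and single substitution, the operations of the calculus, are simultaneous
  substitutions. So every composition of them is computed by one law, \<open>msub_msub\<close> below.\<close>

lemma msub_tm_up: "msub_tm (case_nat a s) (up t) = msub_tm s t"
  by (induction t) auto

lemma msub_tm_under_up [simp]: "msub_tm (under s) (up t) = up (msub_tm s t)"
  by (induction t) (auto simp: under_def)

lemma msub_tm_msub_tm: "msub_tm s (msub_tm r t) = msub_tm (\<lambda>i. msub_tm s (r i)) t"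
  by (induction t) auto

lemma under_comp: "(\<lambda>i. msub_tm (under s) (under r i)) = under (\<lambda>i. msub_tm s (r i))"
proof
  fix i show "msub_tm (under s) (under r i) = under (\<lambda>i. msub_tm s (r i)) i"
    by (cases i) (simp_all add: under_def[of r] under_def[of "\<lambda>i. msub_tm s (r i)"], simp add: under_def)
qed

lemma msub_msub: "msub s (msub r \<phi>) = msub (\<lambda>i. msub_tm s (r i)) \<phi>"
  by (induction \<phi> arbitrary: s r) (simp_all add: msub_tm_msub_tm under_comp)

lemma msub_tm_Var [simp]: "msub_tm Var t = t"
  by (induction t) auto

lemma under_Var [simp]: "under Var = Var"
  by (auto simp: under_def fun_eq_iff split: nat.split)

lemma msub_Var [simp]: "msub Var \<phi> = \<phi>"
  by (induction \<phi>) auto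

lemma msub_tm_cong: "tm_below d t \<Longrightarrow> (\<And>i. i < d \<Longrightarrow> s i = r i) \<Longrightarrow> msub_tm s t = msub_tm r t"
  by (induction t) auto

lemma msub_cong: "fm_below d \<phi> \<Longrightarrow> (\<And>i. i < d \<Longrightarrow> s i = r i) \<Longrightarrow> msub s \<phi> = msub r \<phi>"
proof (induction \<phi> arbitrary: d s r)
  case (All \<phi>)
  have "under s i = under r i" if "i < Suc d" for i
    using that All.prems(2) by (cases i) (auto simp: under_def)
  with All.IH[of "Suc d" "under s" "under r"] All.prems show ?case by simp
next
  case (Ex \<phi>)
  have "under s i = under r i" if "i < Suc d" for i
    using that Ex.prems(2) by (cases i) (auto simp: under_def)
  with Ex.IH[of "Suc d" "under s" "under r"] Ex.prems show ?case by simp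
next
  case (Eq t u) then show ?case using msub_tm_cong[of d _ s r] by simp
next
  case (Less t u) then show ?case using msub_tm_cong[of d _ s r] by simp
next
  case (Neg \<phi>) show ?case using Neg.prems Neg.IH[of d s r] by simp
next
  case (And \<phi> \<psi>) show ?case using And.prems And.IH(1)[of d s r] And.IH(2)[of d s r] by simp
next
  case (Or \<phi> \<psi>) show ?case using Or.prems Or.IH(1)[of d s r] Or.IH(2)[of d s r] by simp
next
  case (Imp \<phi> \<psi>) show ?case using Imp.prems Imp.IH(1)[of d s r] Imp.IH(2)[of d s r] by simp
qed

text \<open>A substitution \<open>e\<close> will play the role of a valuation in a structure whose elements are
  terms: the next two equations are the semantic laws for \<open>subst_fm\<close> and for instantiating a
  quantifier, where the new value becomes the value of variable \<open>0\<close>.\<close>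

lemma msub_subst_0: "msub e (subst_fm 0 t \<phi>) = msub (case_nat (msub_tm e t) e) \<phi>"
  by (simp add: subst_fm_eq_msub msub_msub)
    (rule arg_cong[where f = "\<lambda>s. msub s \<phi>"], auto simp: fun_eq_iff split: nat.split)

lemma subst_0_msub: "subst_fm 0 t (msub (under e) \<phi>) = msub (case_nat t e) \<phi>"
proof -
  have "(\<lambda>i. if i = 0 then t else Var (i - 1)) = case_nat t Var"
    by (auto simp: fun_eq_iff split: nat.split)
  then have "subst_fm 0 t (msub (under e) \<phi>) = msub (\<lambda>i. msub_tm (case_nat t Var) (under e i)) \<phi>"
    by (simp add: subst_fm_eq_msub msub_msub)
  also have "(\<lambda>i. msub_tm (case_nat t Var) (under e i)) = case_nat t e"
    by (auto simp: fun_eq_iff under_def msub_tm_up split: nat.split)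
  finally show ?thesis .
qed

lemma msub_lift_1: "msub e (lift_fm 1 \<phi>) = msub (case_nat (e 0) (\<lambda>i. e (Suc (Suc i)))) \<phi>"
  by (simp add: lift_fm_eq_msub msub_msub)
    (rule arg_cong[where f = "\<lambda>s. msub s \<phi>"], auto simp: fun_eq_iff split: nat.split)

lemma subst_0_lift_1 [simp]: "subst_fm 0 (Var 0) (lift_fm 1 \<phi>) = \<phi>"
proof -
  have "(\<lambda>i. case i of 0 \<Rightarrow> Var 0 | Suc i \<Rightarrow> Var (Suc i)) = Var"
    by (auto simp: fun_eq_iff split: nat.split)
  with msub_subst_0[of Var "Var 0" "lift_fm 1 \<phi>"] show ?thesis
    by (simp add: msub_lift_1 del: One_nat_def)
qed

lemma tm_below_mono: "tm_below d t \<Longrightarrow> d \<le> d' \<Longrightarrow> tm_below d' t"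
  by (induction t) auto

lemma fm_below_mono: "fm_below d \<phi> \<Longrightarrow> d \<le> d' \<Longrightarrow> fm_below d' \<phi>"
proof (induction \<phi> arbitrary: d d')
  case (All \<phi>) then show ?case using All.IH[of "Suc d" "Suc d'"] by simp
next
  case (Ex \<phi>) then show ?case using Ex.IH[of "Suc d" "Suc d'"] by simp
qed (auto intro: tm_below_mono)

lemma ex_tm_below: "\<exists>d. tm_below d t"
proof (induction t)
  case (Plus s t) then show ?case by (metis max.cobounded1 max.cobounded2 tm_below.simps(4) tm_below_mono)
next
  case (Times s t) then show ?case by (metis max.cobounded1 max.cobounded2 tm_below.simps(5) tm_below_mono)
next
  case (Expt s t) then show ?case by (metis max.cobounded1 max.cobounded2 tm_below.simps(6) tm_below_mono)
qed auto

lemma ex_fm_below: "\<exists>d. fm_below d \<phi>"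
proof (induction \<phi>)
  case (Eq s t) then show ?case by (metis ex_tm_below max.cobounded1 max.cobounded2 fm_below.simps(1) tm_below_mono)
next
  case (Less s t) then show ?case by (metis ex_tm_below max.cobounded1 max.cobounded2 fm_below.simps(2) tm_below_mono)
next
  case (And \<phi> \<psi>) then show ?case by (metis max.cobounded1 max.cobounded2 fm_below.simps(4) fm_below_mono)
next
  case (Or \<phi> \<psi>) then show ?case by (metis max.cobounded1 max.cobounded2 fm_below.simps(5) fm_below_mono)
next
  case (Imp \<phi> \<psi>) then show ?case by (metis max.cobounded1 max.cobounded2 fm_below.simps(6) fm_below_mono)
next
  case (All \<phi>) then show ?case by (metis fm_below.simps(7) fm_below_mono le_Suc_eq order_refl)
next
  case (Ex \<phi>) then show ?case by (metis fm_below.simps(8) fm_below_mono le_Suc_eq order_refl)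
qed auto

lemma eval_msub_tm: "eval e (msub_tm s t) = eval (\<lambda>i. eval e (s i)) t"
  by (induction t) auto

lemma sat_msub: "sat e (msub s \<phi>) \<longleftrightarrow> sat (\<lambda>i. eval e (s i)) \<phi>"
proof (induction \<phi> arbitrary: e s)
  case (All \<phi>)
  have "(\<lambda>i. eval (case_nat a e) (under s i)) = case_nat a (\<lambda>i. eval e (s i))" for a
    by (auto simp: fun_eq_iff under_def split: nat.split)
  then show ?case by (simp add: All.IH)
next
  case (Ex \<phi>)
  have "(\<lambda>i. eval (case_nat a e) (under s i)) = case_nat a (\<lambda>i. eval e (s i))" for a
    by (auto simp: fun_eq_iff under_def split: nat.split)
  then show ?case by (simp add: Ex.IH)
qed (auto simp: eval_msub_tm)

section \<open>Henkin completeness of Peano arithmetic\<close>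

text \<open>The quantifiers are instantiated from the outside inwards; this is an induction on their
  number because \<open>All\<close> commutes with the block \<open>All ^^ d\<close>.\<close>

lemma PA_instantiate:
  "PA_proves ((All ^^ d) \<phi>) \<Longrightarrow> PA_proves (msub (\<lambda>i. if i < d then s i else Var (i - d)) \<phi>)"
proof (induction d arbitrary: \<phi> s)
  case (Suc d)
  let ?r = "\<lambda>i. if i < d then s (Suc i) else Var (i - d)"
  have "PA_proves ((All ^^ d) (All \<phi>))"
    using Suc.prems by (simp only: funpow_swap1 funpow.simps o_apply)
  then have "PA_proves (All (msub (under ?r) \<phi>))"
    using Suc.IH[of "All \<phi>" "\<lambda>i. s (Suc i)"] by simp
  then have "PA_proves (subst_fm 0 (s 0) (msub (under ?r) \<phi>))"
    by (rule MP[OF Logic[OF AllE]])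
  moreover have "case_nat (s 0) ?r = (\<lambda>i. if i < Suc d then s i else Var (i - Suc d))"
    by (auto simp: fun_eq_iff split: nat.split)
  ultimately show ?case by (simp only: subst_0_msub)
qed simp

text \<open>A theorem with free variables is as good as its universal closure, which can be instantiated
  with any terms.\<close>

lemma PA_proves_msub:
  assumes "PA_proves \<phi>" shows "PA_proves (msub s \<phi>)"
proof -
  obtain d where "fm_below d \<phi>" using ex_fm_below by blast
  moreover have "PA_proves ((All ^^ d) \<phi>)" by (induction d) (auto intro: assms Gen)
  ultimately show ?thesis
    using PA_instantiate[of d \<phi> s] msub_cong[of d \<phi> s "\<lambda>i. if i < d then s i else Var (i - d)"] by simp
qed

text \<open>Derivability from assumptions uses modus ponens as its only rule: generalization is confined to
  theorems, so that the deduction theorem holds for formulas with free variables.\<close>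

inductive derives :: "fm set \<Rightarrow> fm \<Rightarrow> bool" for \<Gamma> where
  base: "PA_proves \<phi> \<Longrightarrow> derives \<Gamma> \<phi>"
| asm: "\<phi> \<in> \<Gamma> \<Longrightarrow> derives \<Gamma> \<phi>"
| mp: "derives \<Gamma> (Imp \<phi> \<psi>) \<Longrightarrow> derives \<Gamma> \<phi> \<Longrightarrow> derives \<Gamma> \<psi>"

lemma derives_logical: "logical_axiom \<phi> \<Longrightarrow> derives \<Gamma> \<phi>"
  by (intro base Logic)

lemma derives_mono: "derives \<Gamma> \<phi> \<Longrightarrow> \<Gamma> \<subseteq> \<Delta> \<Longrightarrow> derives \<Delta> \<phi>"
  by (induction rule: derives.induct) (auto intro: derives.intros)

lemma derives_empty: "derives {} \<phi> \<Longrightarrow> PA_proves \<phi>"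
  by (induction rule: derives.induct) (auto intro: PA_proves.intros)

lemma derives_weaken: "derives \<Gamma> \<psi> \<Longrightarrow> derives \<Gamma> (Imp \<phi> \<psi>)"
  by (rule mp[OF derives_logical[OF K]])

lemma deduction:
  "derives (insert \<phi> \<Gamma>) \<psi> \<Longrightarrow> derives \<Gamma> (Imp \<phi> \<psi>)"
proof (induction rule: derives.induct)
  case (asm \<psi>)
  have "derives \<Gamma> (Imp \<phi> \<phi>)"
    by (rule mp[OF mp[OF derives_logical[OF S] derives_logical[OF K]] derives_logical[OF K[of \<phi> \<phi>]]])
  with asm show ?case by (auto intro: derives_weaken derives.asm)
next
  case (mp \<psi> \<chi>)
  then show ?case using derives.mp[OF derives.mp[OF derives_logical[OF S]]] by blast
qed (auto intro: derives_weaken derives.base)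

lemma derives_cut: "derives (insert \<phi> \<Gamma>) \<psi> \<Longrightarrow> derives \<Gamma> \<phi> \<Longrightarrow> derives \<Gamma> \<psi>"
  by (rule mp[OF deduction])

definition consistent :: "fm set \<Rightarrow> bool" where
  "consistent \<Gamma> \<longleftrightarrow> \<not> derives \<Gamma> (Neg (Eq Zero Zero))"

lemma derives_contradiction: "derives \<Gamma> \<phi> \<Longrightarrow> derives \<Gamma> (Neg \<phi>) \<Longrightarrow> derives \<Gamma> \<psi>"
  by (rule mp[OF mp[OF derives_logical[OF Contrapos] derives_weaken]])

lemma inconsistent_derives: "\<not> consistent \<Gamma> \<Longrightarrow> derives \<Gamma> \<phi>"
  unfolding consistent_def using derives_contradiction derives_logical[OF Refl] by blast

lemma derives_ccontr:
  assumes "\<not> consistent (insert (Neg \<phi>) \<Gamma>)" shows "derives \<Gamma> \<phi>"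
proof -
  have "derives \<Gamma> (Imp (Neg \<phi>) (Neg (Eq Zero Zero)))"
    using inconsistent_derives[OF assms] by (rule deduction)
  then show ?thesis
    using mp[OF mp[OF derives_logical[OF Contrapos]]] derives_logical[OF Refl] by blast
qed

lemma derives_Neg:
  assumes "\<not> consistent (insert \<phi> \<Gamma>)" shows "derives \<Gamma> (Neg \<phi>)"
proof (rule derives_ccontr)
  let ?\<Delta> = "insert (Neg (Neg \<phi>)) \<Gamma>"
  have "derives ?\<Delta> \<phi>"
  proof (rule derives_ccontr)
    show "\<not> consistent (insert (Neg \<phi>) ?\<Delta>)"
      unfolding consistent_def by (auto intro: derives_contradiction[of _ "Neg \<phi>"] asm)
  qed
  moreover have "derives (insert \<phi> ?\<Delta>) (Neg (Eq Zero Zero))"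
    using inconsistent_derives[OF assms] by (rule derives_mono) auto
  ultimately show "\<not> consistent ?\<Delta>"
    unfolding consistent_def using derives_cut by blast
qed

lemma derives_msub: "derives \<Gamma> \<phi> \<Longrightarrow> derives (msub s ` \<Gamma>) (msub s \<phi>)"
  by (induction rule: derives.induct) (auto intro: derives.intros PA_proves_msub)

lemma PA_All_distrib: "PA_proves (Imp (All (Imp \<phi> \<psi>)) (Imp (All \<phi>) (All \<psi>)))"
proof -
  let ?a = "All (Imp \<phi> \<psi>)" and ?b = "All \<phi>"
  let ?\<Gamma> = "{lift_fm 0 ?b, lift_fm 0 ?a}"
  have "derives ?\<Gamma> (subst_fm 0 (Var 0) (lift_fm 1 (Imp \<phi> \<psi>)))"
    by (rule mp[OF derives_logical[OF AllE]]) (auto intro: asm)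
  moreover have "derives ?\<Gamma> (subst_fm 0 (Var 0) (lift_fm 1 \<phi>))"
    by (rule mp[OF derives_logical[OF AllE]]) (auto intro: asm)
  ultimately have "derives ?\<Gamma> \<psi>"
    by (simp only: subst_0_lift_1) (rule mp)
  then have "PA_proves (Imp (lift_fm 0 ?a) (Imp (lift_fm 0 ?b) \<psi>))"
    by (intro derives_empty deduction)
  then have "derives {?a} (All (Imp (lift_fm 0 ?a) (Imp (lift_fm 0 ?b) \<psi>)))"
    by (intro base Gen)
  then have "derives {?a} (All (Imp (lift_fm 0 ?b) \<psi>))"
    by (rule mp[OF mp[OF derives_logical[OF AllI]] asm]) simp
  then have "derives {?a} (Imp ?b (All \<psi>))"
    by (rule mp[OF derives_logical[OF AllI]])
  then show ?thesis by (rule derives_empty[OF deduction])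
qed

text \<open>Generalization is admissible when variable \<open>0\<close> does not occur in the assumptions, that is, when
  all of them are lifted.\<close>

lemma derives_Gen: "derives (lift_fm 0 ` \<Gamma>) \<phi> \<Longrightarrow> derives \<Gamma> (All \<phi>)"
proof (induction rule: derives.induct)
  case (asm \<phi>)
  then obtain \<psi> where \<psi>: "\<psi> \<in> \<Gamma>" "\<phi> = lift_fm 0 \<psi>" by blast
  have "derives {} (Imp \<phi> \<phi>)" by (intro deduction derives.asm) simp
  then have "PA_proves (All (Imp \<phi> \<phi>))" by (intro Gen derives_empty)
  then show ?case
    using mp[OF mp[OF derives_logical[OF AllI]] derives.asm[OF \<psi>(1)]] \<psi>(2) base by blast
next
  case (mp \<phi> \<psi>)
  then show ?case using derives.mp[OF derives.mp[OF base[OF PA_All_distrib]]] by blast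
qed (auto intro: base Gen)

text \<open>Adding a witness for an existential formula is harmless if the witness is a fresh variable
  \<open>v\<close>. A refutation of the witnessing formula from \<open>\<Gamma>\<close> can be renamed so that \<open>v\<close> becomes
  variable \<open>0\<close> and all other variables are lifted; generalizing it then refutes the existential
  formula itself.\<close>

lemma consistent_witness:
  assumes "consistent \<Gamma>" "Ex \<chi> \<in> \<Gamma>" and fresh: "\<And>\<psi>. \<psi> \<in> \<Gamma> \<Longrightarrow> fm_below v \<psi>"
  shows "consistent (insert (subst_fm 0 (Var v) \<chi>) \<Gamma>)"
proof (rule ccontr)
  assume "\<not> ?thesis"
  then have "derives \<Gamma> (Neg (subst_fm 0 (Var v) \<chi>))" by (rule derives_Neg)
  define s where "s i = Var (if i = v then 0 else Suc i)" for i
  have "derives (msub s ` \<Gamma>) (Neg (msub s (subst_fm 0 (Var v) \<chi>)))"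
    using derives_msub[OF \<open>derives \<Gamma> _\<close>, of s] by simp
  moreover have "msub s ` \<Gamma> = lift_fm 0 ` \<Gamma>"
  proof (rule image_cong)
    fix \<psi> assume "\<psi> \<in> \<Gamma>"
    then show "msub s \<psi> = lift_fm 0 \<psi>"
      unfolding lift_fm_eq_msub by (intro msub_cong[OF fresh]) (auto simp: s_def)
  qed simp
  moreover have "msub s (subst_fm 0 (Var v) \<chi>) = \<chi>"
  proof -
    have "fm_below (Suc v) \<chi>" using fresh[OF assms(2)] by simp
    then have "msub (case_nat (s v) s) \<chi> = msub Var \<chi>"
      by (rule msub_cong) (auto simp: s_def split: nat.split)
    then show ?thesis by (simp add: msub_subst_0)
  qed
  ultimately have neg: "derives (lift_fm 0 ` \<Gamma>) (Neg \<chi>)" by simp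
  let ?bot = "Neg (Eq Zero Zero)"
  have "derives (lift_fm 0 ` \<Gamma>) (Imp \<chi> (lift_fm 0 ?bot))"
    by (rule deduction[OF derives_contradiction[OF asm[OF insertI1] derives_mono[OF neg]]]) auto
  then have "derives \<Gamma> (All (Imp \<chi> (lift_fm 0 ?bot)))" by (rule derives_Gen)
  then have "derives \<Gamma> ?bot"
    using mp[OF mp[OF derives_logical[OF ExE]] asm[OF assms(2)]] by blast
  with assms(1) show False by (simp add: consistent_def)
qed

text \<open>Membership in a Henkin set obeys the truth definition of Tarski, with the terms as the elements
  of the structure.\<close>

definition henkin :: "fm set \<Rightarrow> bool" where
  "henkin H \<longleftrightarrow>
     (\<forall>\<phi>. PA_proves \<phi> \<longrightarrow> \<phi> \<in> H) \<and>
     (\<forall>\<phi>. Neg \<phi> \<in> H \<longleftrightarrow> \<phi> \<notin> H) \<and>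
     (\<forall>\<phi> \<psi>. And \<phi> \<psi> \<in> H \<longleftrightarrow> \<phi> \<in> H \<and> \<psi> \<in> H) \<and>
     (\<forall>\<phi> \<psi>. Or \<phi> \<psi> \<in> H \<longleftrightarrow> \<phi> \<in> H \<or> \<psi> \<in> H) \<and>
     (\<forall>\<phi> \<psi>. Imp \<phi> \<psi> \<in> H \<longleftrightarrow> (\<phi> \<in> H \<longrightarrow> \<psi> \<in> H)) \<and>
     (\<forall>\<phi>. All \<phi> \<in> H \<longleftrightarrow> (\<forall>t. subst_fm 0 t \<phi> \<in> H)) \<and>
     (\<forall>\<phi>. Ex \<phi> \<in> H \<longleftrightarrow> (\<exists>t. subst_fm 0 t \<phi> \<in> H))"

lemma derives_not_Ex_Neg: "derives {Neg (Ex (Neg \<phi>))} (All \<phi>)"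
proof (rule derives_Gen, rule derives_ccontr)
  let ?\<Gamma> = "insert (Neg \<phi>) (lift_fm 0 ` {Neg (Ex (Neg \<phi>))})"
  have "derives ?\<Gamma> (subst_fm 0 (Var 0) (lift_fm 1 (Neg \<phi>)))"
    by (simp only: subst_0_lift_1) (auto intro: asm)
  then have "derives ?\<Gamma> (Ex (lift_fm 1 (Neg \<phi>)))" by (rule mp[OF derives_logical[OF ExI]])
  moreover have "derives ?\<Gamma> (Neg (Ex (lift_fm 1 (Neg \<phi>))))" by (auto intro: asm)
  ultimately show "\<not> consistent ?\<Gamma>"
    unfolding consistent_def by (auto intro: derives_contradiction)
qed

text \<open>The witness is a variable that is fresh for the finite set \<open>\<Gamma>\<close>. Finitely many formulas leave
  infinitely many variables unused, so no constants have to be added to the language.\<close>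

definition witnesses :: "fm set \<Rightarrow> fm \<Rightarrow> fm set" where
  "witnesses \<Gamma> \<phi> = (case \<phi> of Ex \<chi> \<Rightarrow> {subst_fm 0 (Var (SOME v. \<forall>\<psi>\<in>\<Gamma>. fm_below v \<psi>)) \<chi>} | _ \<Rightarrow> {})"

primrec henkin_seq :: "fm \<Rightarrow> nat \<Rightarrow> fm set" where
  "henkin_seq \<phi> 0 = {Neg \<phi>}"
| "henkin_seq \<phi> (Suc i) = (let \<Gamma> = henkin_seq \<phi> i; \<Delta> = insert (inv fm_code i) \<Gamma> in
     if consistent \<Delta> then witnesses \<Delta> (inv fm_code i) \<union> \<Delta> else \<Gamma>)"

lemma ex_fresh: "finite \<Gamma> \<Longrightarrow> \<exists>v. \<forall>\<psi>\<in>\<Gamma>. fm_below v \<psi>"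
proof (induction rule: finite_induct)
  case (insert \<phi> \<Gamma>)
  then show ?case by (metis ex_fm_below fm_below_mono insert_iff nat_le_linear)
qed simp

lemma henkin_seq_finite: "finite (henkin_seq \<phi> i)"
  by (induction i) (auto simp: Let_def witnesses_def split: fm.split)

lemma consistent_witnesses:
  assumes "finite \<Delta>" "consistent \<Delta>" "\<phi> \<in> \<Delta>"
  shows "consistent (witnesses \<Delta> \<phi> \<union> \<Delta>)"
proof (cases \<phi>)
  case (Ex \<chi>)
  have "\<forall>\<psi>\<in>\<Delta>. fm_below (SOME v. \<forall>\<psi>\<in>\<Delta>. fm_below v \<psi>) \<psi>"
    by (rule someI_ex[OF ex_fresh[OF assms(1)]])
  then show ?thesis
    using consistent_witness[OF assms(2), of \<chi>] assms(3) Ex by (simp add: witnesses_def)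
qed (use assms in \<open>auto simp: witnesses_def\<close>)

lemma henkin_seq_consistent: 
  assumes "\<not> PA_proves \<phi>" shows "consistent (henkin_seq \<phi> i)"
proof (induction i)
  case 0
  show ?case using derives_ccontr[of \<phi> "{}"] derives_empty assms by auto
next
  case (Suc i)
  let ?\<Delta> = "insert (inv fm_code i) (henkin_seq \<phi> i)"
  have "consistent (witnesses ?\<Delta> (inv fm_code i) \<union> ?\<Delta>)" if "consistent ?\<Delta>"
    using that by (rule consistent_witnesses[rotated]) (simp_all add: henkin_seq_finite)
  with Suc show ?case by (simp add: Let_def)
qed

lemma henkin_seq_mono: "i \<le> j \<Longrightarrow> henkin_seq \<phi> i \<subseteq> henkin_seq \<phi> j"
  by (rule lift_Suc_mono_le) (auto simp: Let_def)

lemma derives_Union_henkin_seq: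
  "derives (\<Union>i. henkin_seq \<phi> i) \<psi> \<Longrightarrow> \<exists>i. derives (henkin_seq \<phi> i) \<psi>"
proof (induction rule: derives.induct)
  case (mp \<psi> \<chi>)
  then obtain i j where "derives (henkin_seq \<phi> i) (Imp \<psi> \<chi>)" "derives (henkin_seq \<phi> j) \<psi>" by blast
  then have "derives (henkin_seq \<phi> (max i j)) (Imp \<psi> \<chi>)" "derives (henkin_seq \<phi> (max i j)) \<psi>"
    using derives_mono[OF _ henkin_seq_mono[of _ "max i j" \<phi>]] by simp_all
  then show ?case by (blast intro: derives.mp)
qed (auto intro: derives.intros)

text \<open>The completeness theorem in the form used here: what is unprovable fails in some Henkin set.
  The set is the union of \<open>henkin_seq \<phi>\<close>, which decides the formulas in the order of their codes.
  It turns every proof in \<open>PA\<close> below into semantic reasoning about an arbitrary Henkin set.\<close>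

theorem henkin_completeness:
  assumes "\<not> PA_proves \<phi>"
  obtains H where "henkin H" "\<phi> \<notin> H"
proof
  define H where "H = (\<Union>i. henkin_seq \<phi> i)"
  have cons: "consistent H"
    using derives_Union_henkin_seq henkin_seq_consistent[OF assms]
    unfolding consistent_def H_def by blast
  have max: "derives H (Neg \<psi>)" if "\<psi> \<notin> H" for \<psi>
  proof -
    have \<psi>: "inv fm_code (fm_code \<psi>) = \<psi>" by (simp add: inj_fm_code)
    have "\<psi> \<notin> henkin_seq \<phi> (Suc (fm_code \<psi>))" using that unfolding H_def by blast
    then have "\<not> consistent (insert \<psi> (henkin_seq \<phi> (fm_code \<psi>)))"
      by (auto simp: Let_def \<psi> split: if_splits)
    then have "derives (henkin_seq \<phi> (fm_code \<psi>)) (Neg \<psi>)" by (rule derives_Neg)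
    then show ?thesis by (rule derives_mono) (auto simp: H_def)
  qed
  have mem: "derives H \<psi> \<longleftrightarrow> \<psi> \<in> H" for \<psi>
    using max[of \<psi>] cons derives_contradiction[of H \<psi>] unfolding consistent_def by (blast intro: asm)
  have Neg: "Neg \<psi> \<in> H \<longleftrightarrow> \<psi> \<notin> H" for \<psi>
    using max[of \<psi>] cons derives_contradiction[of H \<psi>] mem unfolding consistent_def by blast
  have mpH: "Imp \<psi> \<chi> \<in> H \<Longrightarrow> \<psi> \<in> H \<Longrightarrow> \<chi> \<in> H" for \<psi> \<chi>
    unfolding mem[symmetric] by (rule mp)
  have ax: "logical_axiom \<psi> \<Longrightarrow> \<psi> \<in> H" for \<psi>
    unfolding mem[symmetric] by (rule derives_logical)
  have Imp: "Imp \<psi> \<chi> \<in> H \<longleftrightarrow> (\<psi> \<in> H \<longrightarrow> \<chi> \<in> H)" for \<psi> \<chi>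
  proof
    assume *: "\<psi> \<in> H \<longrightarrow> \<chi> \<in> H"
    show "Imp \<psi> \<chi> \<in> H"
    proof (cases "\<psi> \<in> H")
      case True
      with * show ?thesis using mpH[OF ax[OF K]] by blast
    next
      case False
      then have "derives (insert \<psi> H) (Neg \<psi>)"
        by (intro derives_mono[OF max]) auto
      then have "derives H (Imp \<psi> \<chi>)"
        by (rule deduction[OF derives_contradiction[OF asm[OF insertI1]]])
      then show ?thesis by (simp add: mem)
    qed
  qed (blast intro: mpH)
  have And: "And \<psi> \<chi> \<in> H \<longleftrightarrow> \<psi> \<in> H \<and> \<chi> \<in> H" for \<psi> \<chi>
    using ax[OF AndI[of \<psi> \<chi>]] ax[OF AndE1[of \<psi> \<chi>]] ax[OF AndE2[of \<psi> \<chi>]] by (auto simp: Imp)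
  have Or: "Or \<psi> \<chi> \<in> H \<longleftrightarrow> \<psi> \<in> H \<or> \<chi> \<in> H" for \<psi> \<chi>
    using ax[OF OrI1[of \<psi> \<chi>]] ax[OF OrI2[of \<chi> \<psi>]] ax[OF OrE[of \<psi> "Neg (Eq Zero Zero)" \<chi>]]
      ax[OF Refl[of Zero]] by (auto simp: Imp Neg)
  have Ex: "Ex \<psi> \<in> H \<longleftrightarrow> (\<exists>t. subst_fm 0 t \<psi> \<in> H)" for \<psi>
  proof
    assume *: "Ex \<psi> \<in> H"
    let ?i = "fm_code (Ex \<psi>)" and ?\<Delta> = "insert (Ex \<psi>) (henkin_seq \<phi> (fm_code (Ex \<psi>)))"
    have i: "inv fm_code ?i = Ex \<psi>" by (simp add: inj_fm_code del: fm_code.simps)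
    have "?\<Delta> \<subseteq> H" using * by (auto simp: H_def)
    then have "consistent ?\<Delta>" using cons derives_mono unfolding consistent_def by blast
    then have "witnesses ?\<Delta> (Ex \<psi>) \<subseteq> henkin_seq \<phi> (Suc ?i)"
      by (auto simp add: Let_def i simp del: fm_code.simps)
    then have "witnesses ?\<Delta> (Ex \<psi>) \<subseteq> H" unfolding H_def by blast
    then show "\<exists>t. subst_fm 0 t \<psi> \<in> H" by (auto simp: witnesses_def)
  next
    assume "\<exists>t. subst_fm 0 t \<psi> \<in> H"
    then show "Ex \<psi> \<in> H" using mpH[OF ax[OF ExI]] by blast
  qed
  have All: "All \<psi> \<in> H \<longleftrightarrow> (\<forall>t. subst_fm 0 t \<psi> \<in> H)" for \<psi>
  proof
    assume "All \<psi> \<in> H"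
    then show "\<forall>t. subst_fm 0 t \<psi> \<in> H" using mpH[OF ax[OF AllE]] by blast
  next
    assume "\<forall>t. subst_fm 0 t \<psi> \<in> H"
    then have "Neg (Ex (Neg \<psi>)) \<in> H" by (simp add: Neg Ex)
    then have "derives H (All \<psi>)" using derives_mono[OF derives_not_Ex_Neg] by simp
    then show "All \<psi> \<in> H" by (simp add: mem)
  qed
  have "PA_proves \<psi> \<Longrightarrow> \<psi> \<in> H" for \<psi>
    unfolding mem[symmetric] by (rule base)
  then show "henkin H"
    unfolding henkin_def by (simp only: Neg And Or Imp All[symmetric] Ex[symmetric]) simp
  have "Neg \<phi> \<in> henkin_seq \<phi> 0" by simp
  then have "Neg \<phi> \<in> H" unfolding H_def by blast
  then show "\<phi> \<notin> H" by (simp add: Neg)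
qed

section \<open>Arithmetic in a Henkin theory\<close>

text \<open>Truth in the term structure given by \<open>H\<close> under the valuation \<open>e\<close>. Two terms \<open>s\<close> and \<open>t\<close> with
  \<open>Eq s t \<in> H\<close> are equal elements of this structure; no quotient is formed, since Leibniz's law
  makes them indiscernible.\<close>

definition true_in :: "fm set \<Rightarrow> (nat \<Rightarrow> tm) \<Rightarrow> fm \<Rightarrow> bool" where
  "true_in H e \<phi> \<longleftrightarrow> msub e \<phi> \<in> H"

lemma PA_provesI: "(\<And>H e. henkin H \<Longrightarrow> true_in H e \<phi>) \<Longrightarrow> PA_proves \<phi>"
  by (metis henkin_completeness msub_Var true_in_def)

lemma true_in_msub: "true_in H e (msub s \<phi>) \<longleftrightarrow> true_in H (\<lambda>i. msub_tm e (s i)) \<phi>"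
  by (simp add: true_in_def msub_msub)

lemma true_in_lift_1: "true_in H e (lift_fm 1 \<phi>) \<longleftrightarrow> true_in H (case_nat (e 0) (\<lambda>i. e (Suc (Suc i)))) \<phi>"
  unfolding true_in_def msub_lift_1 ..

lemma true_in_atoms [simp]:
  "true_in H e (Eq s t) \<longleftrightarrow> Eq (msub_tm e s) (msub_tm e t) \<in> H"
  "true_in H e (Less s t) \<longleftrightarrow> Less (msub_tm e s) (msub_tm e t) \<in> H"
  by (simp_all add: true_in_def)

lemma msub_tm_num [simp]: "msub_tm s (num n) = num n"
  by (induction n) auto

definition BAll :: "tm \<Rightarrow> fm \<Rightarrow> fm" where
  "BAll t \<phi> = All (Imp (Less (Var 0) (up t)) \<phi>)"

definition BEx :: "tm \<Rightarrow> fm \<Rightarrow> fm" where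
  "BEx t \<phi> = Ex (And (Less (Var 0) (up t)) \<phi>)"

lemma sat_bounded [simp]:
  "sat e (BAll t \<phi>) \<longleftrightarrow> (\<forall>a<eval e t. sat (case_nat a e) \<phi>)"
  "sat e (BEx t \<phi>) \<longleftrightarrow> (\<exists>a<eval e t. sat (case_nat a e) \<phi>)"
  by (simp_all add: BAll_def BEx_def)

lemma bounded_fm_intros [intro]:
  "bounded_fm (Eq s t)" "bounded_fm (Less s t)"
  "bounded_fm \<phi> \<Longrightarrow> bounded_fm (Neg \<phi>)"
  "bounded_fm \<phi> \<Longrightarrow> bounded_fm \<psi> \<Longrightarrow> bounded_fm (And \<phi> \<psi>)"
  "bounded_fm \<phi> \<Longrightarrow> bounded_fm \<psi> \<Longrightarrow> bounded_fm (Or \<phi> \<psi>)"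
  "bounded_fm \<phi> \<Longrightarrow> bounded_fm \<psi> \<Longrightarrow> bounded_fm (Imp \<phi> \<psi>)"
  "bounded_fm \<phi> \<Longrightarrow> bounded_fm (BAll t \<phi>)" "bounded_fm \<phi> \<Longrightarrow> bounded_fm (BEx t \<phi>)"
  by (auto simp: BAll_def BEx_def intro: bounded_fm.intros)

lemma fm_below_bounded [simp]:
  "fm_below d (BAll t \<phi>) \<longleftrightarrow> tm_below d t \<and> fm_below (Suc d) \<phi>"
  "fm_below d (BEx t \<phi>) \<longleftrightarrow> tm_below d t \<and> fm_below (Suc d) \<phi>"
proof -
  have "tm_below (Suc d) (up t) \<longleftrightarrow> tm_below d t" for t by (induction t) auto
  then show "fm_below d (BAll t \<phi>) \<longleftrightarrow> tm_below d t \<and> fm_below (Suc d) \<phi>"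
    "fm_below d (BEx t \<phi>) \<longleftrightarrow> tm_below d t \<and> fm_below (Suc d) \<phi>"
    by (auto simp: BAll_def BEx_def)
qed

lemma bounded_fm_msub: "bounded_fm \<phi> \<Longrightarrow> bounded_fm (msub s \<phi>)"
proof (induction arbitrary: s rule: bounded_fm.induct)
  case (7 \<phi> t)
  have "msub s (All (Imp (Less (Var 0) (up t)) \<phi>)) = BAll (msub_tm s t) (msub (under s) \<phi>)"
    by (simp add: BAll_def) (simp add: under_def)
  then show ?case using 7 by auto
next
  case (8 \<phi> t)
  have "msub s (Ex (And (Less (Var 0) (up t)) \<phi>)) = BEx (msub_tm s t) (msub (under s) \<phi>)"
    by (simp add: BEx_def) (simp add: under_def)
  then show ?case using 8 by auto
qed auto

lemma tm_below_msub_tm: "(\<And>i. tm_below d (s i)) \<Longrightarrow> tm_below d (msub_tm s t)"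
  by (induction t) auto

lemma tm_below_lift: "tm_below d t \<Longrightarrow> tm_below (Suc d) (up t)"
  by (induction t) auto

text \<open>Every free variable of the result comes from a term in the range of the substitution. This gives
  the free variables of a formula obtained from \<open>\<phi>\<close> without an analysis of \<open>\<phi>\<close>.\<close>

lemma fm_below_msub: "(\<And>i. tm_below d (s i)) \<Longrightarrow> fm_below d (msub s \<phi>)"
proof (induction \<phi> arbitrary: d s)
  case (All \<phi>)
  have "tm_below (Suc d) (under s i)" for i
    using All.prems by (auto simp: under_def tm_below_lift split: nat.split)
  with All.IH show ?case by simp
next
  case (Ex \<phi>)
  have "tm_below (Suc d) (under s i)" for i
    using Ex.prems by (auto simp: under_def tm_below_lift split: nat.split)
  with Ex.IH show ?case by simp
qed (auto intro: tm_below_msub_tm)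

context
  fixes H assumes H: "henkin H"
begin

lemma true_in_connectives [simp]:
  "true_in H e (Neg \<phi>) \<longleftrightarrow> \<not> true_in H e \<phi>"
  "true_in H e (And \<phi> \<psi>) \<longleftrightarrow> true_in H e \<phi> \<and> true_in H e \<psi>"
  "true_in H e (Or \<phi> \<psi>) \<longleftrightarrow> true_in H e \<phi> \<or> true_in H e \<psi>"
  "true_in H e (Imp \<phi> \<psi>) \<longleftrightarrow> (true_in H e \<phi> \<longrightarrow> true_in H e \<psi>)"
  "true_in H e (Iff \<phi> \<psi>) \<longleftrightarrow> (true_in H e \<phi> \<longleftrightarrow> true_in H e \<psi>)"
  "true_in H e (All \<phi>) \<longleftrightarrow> (\<forall>t. true_in H (case_nat t e) \<phi>)"
  "true_in H e (Ex \<phi>) \<longleftrightarrow> (\<exists>t. true_in H (case_nat t e) \<phi>)"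
  using H by (auto simp: true_in_def henkin_def Iff_def subst_0_msub)

lemma true_in_bounded [simp]:
  "true_in H e (BAll t \<phi>) \<longleftrightarrow> (\<forall>a. Less a (msub_tm e t) \<in> H \<longrightarrow> true_in H (case_nat a e) \<phi>)"
  "true_in H e (BEx t \<phi>) \<longleftrightarrow> (\<exists>a. Less a (msub_tm e t) \<in> H \<and> true_in H (case_nat a e) \<phi>)"
  by (simp_all add: BAll_def BEx_def msub_tm_up)

lemma true_in_PA: "PA_proves \<phi> \<Longrightarrow> true_in H e \<phi>"
  using H PA_proves_msub by (auto simp: true_in_def henkin_def)

lemma true_in_Leibniz:
  assumes "Eq s t \<in> H" "true_in H (case_nat s e) \<phi>" shows "true_in H (case_nat t e) \<phi>"
proof -
  have "true_in H Var (Imp (Eq s t) (Imp (subst_fm 0 s (msub (under e) \<phi>)) (subst_fm 0 t (msub (under e) \<phi>))))"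
    by (intro true_in_PA Logic Leibniz)
  then show ?thesis using assms by (simp add: subst_0_msub) (simp add: true_in_def)
qed

lemma true_in_induct:
  assumes "true_in H (case_nat Zero e) \<phi>"
    and "\<And>t. true_in H (case_nat t e) \<phi> \<Longrightarrow> true_in H (case_nat (Succ t) e) \<phi>"
  shows "true_in H (case_nat t e) \<phi>"
proof -
  have step: "true_in H (case_nat t e) (subst_fm 0 (Succ (Var 0)) (lift_fm 1 \<phi>)) \<longleftrightarrow> true_in H (case_nat (Succ t) e) \<phi>" for t
    unfolding true_in_def msub_subst_0 msub_lift_1 by simp
  have zero: "true_in H e (subst_fm 0 Zero \<phi>) \<longleftrightarrow> true_in H (case_nat Zero e) \<phi>"
    unfolding true_in_def msub_subst_0 by simp
  have "true_in H e (And (subst_fm 0 Zero \<phi>) (All (Imp \<phi> (subst_fm 0 (Succ (Var 0)) (lift_fm 1 \<phi>)))))"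
    unfolding true_in_connectives zero step using assms by blast
  moreover have "true_in H e (Imp (And (subst_fm 0 Zero \<phi>)
      (All (Imp \<phi> (subst_fm 0 (Succ (Var 0)) (lift_fm 1 \<phi>))))) (All \<phi>))"
    by (rule true_in_PA[OF Axiom[OF Induction]])
  ultimately have "true_in H e (All \<phi>)" unfolding true_in_connectives(4) by (rule rev_mp)
  then show ?thesis by simp
qed

text \<open>The order facts that follow are the only arithmetic proved in \<open>PA\<close>. They are theorems about
  the structure of a Henkin set \<open>H\<close>, in which induction holds for the sets defined by formulas.\<close>

lemma less_Zero: "Less a Zero \<notin> H"
  using true_in_PA[OF Axiom[OF Less_Zero], of "\<lambda>_. a"] by simp

lemma less_Succ: "Less a (Succ b) \<in> H \<longleftrightarrow> Less a b \<in> H \<or> Eq a b \<in> H"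
  using true_in_PA[OF Axiom[OF Less_Succ], of "case_nat a (\<lambda>_. b)"] by simp

lemma eq_refl: "Eq a a \<in> H"
  using true_in_PA[OF Logic[OF Refl[of a]], of Var] by simp

lemma eq_sym: "Eq a b \<in> H \<Longrightarrow> Eq b a \<in> H"
  using true_in_Leibniz[of a b "\<lambda>_. a" "Eq (Var 0) (Var 1)"] eq_refl by simp

lemma less_eq_right: "Eq a b \<in> H \<Longrightarrow> Less c a \<in> H \<Longrightarrow> Less c b \<in> H"
  using true_in_Leibniz[of a b "\<lambda>_. c" "Less (Var 1) (Var 0)"] by simp

lemma eq_Succ: "Eq a b \<in> H \<Longrightarrow> Eq (Succ a) (Succ b) \<in> H"
  using true_in_Leibniz[of a b "\<lambda>_. a" "Eq (Succ (Var 1)) (Succ (Var 0))"] eq_refl by simp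

lemma eq_Zero_or_positive: "Eq Zero a \<in> H \<or> Less Zero a \<in> H"
  using true_in_induct[of "\<lambda>_. Zero" "Or (Eq Zero (Var 0)) (Less Zero (Var 0))" a]
  by (auto simp: less_Succ eq_refl)

lemma Succ_le: "Less b a \<in> H \<Longrightarrow> Less (Succ b) a \<in> H \<or> Eq (Succ b) a \<in> H"
  using true_in_induct[of "\<lambda>_. b"
      "Imp (Less (Var 1) (Var 0)) (Or (Less (Succ (Var 1)) (Var 0)) (Eq (Succ (Var 1)) (Var 0)))" a]
  by (auto simp: less_Succ less_Zero intro: eq_Succ)

lemma less_linear: "Less a b \<in> H \<or> Eq a b \<in> H \<or> Less b a \<in> H"
  using true_in_induct[of "\<lambda>_. a"
      "Or (Less (Var 1) (Var 0)) (Or (Eq (Var 1) (Var 0)) (Less (Var 0) (Var 1)))" b]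
    eq_Zero_or_positive[of a]
  by (auto simp: less_Succ dest: eq_sym Succ_le)

lemma less_trans: "Less a b \<in> H \<Longrightarrow> Less b c \<in> H \<Longrightarrow> Less a c \<in> H"
  using true_in_induct[of "case_nat a (\<lambda>_. b)"
      "Imp (Less (Var 1) (Var 2)) (Imp (Less (Var 2) (Var 0)) (Less (Var 1) (Var 0)))" c]
  by (auto simp: less_Succ less_Zero numeral_2_eq_2 intro: less_eq_right)

lemma upper_bound: "\<exists>m. (\<forall>z. Less z a \<in> H \<longrightarrow> Less z m \<in> H) \<and> Less b m \<in> H"
proof (cases "Less b a \<in> H")
  case False
  then have "Less a b \<in> H \<or> Eq a b \<in> H" using less_linear[of a b] by blast
  then have "\<forall>z. Less z a \<in> H \<longrightarrow> Less z (Succ b) \<in> H"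
    by (auto simp: less_Succ intro: less_trans less_eq_right)
  moreover have "Less b (Succ b) \<in> H" by (simp add: less_Succ eq_refl)
  ultimately show ?thesis by blast
qed blast

end

section \<open>Choosing a least solution\<close>

text \<open>Variable \<open>0\<close> of \<open>R\<close> becomes \<open>a\<close>, variable \<open>1\<close> becomes \<open>b\<close>, and all others become \<open>c\<close>. So \<open>inst R a b c\<close> behaves like an atomic formula with the arguments
  \<open>a\<close>, \<open>b\<close>, \<open>c\<close>, for every \<open>R\<close>.\<close>

definition inst :: "fm \<Rightarrow> tm \<Rightarrow> tm \<Rightarrow> tm \<Rightarrow> fm" where
  "inst R a b c = msub (case_nat a (case_nat b (\<lambda>_. c))) R"

lemma comp_case_nat:
  "(\<lambda>i. f (case_nat a (case_nat b (\<lambda>_. c)) i)) = case_nat (f a) (case_nat (f b) (\<lambda>_. f c))"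
  by (auto simp: fun_eq_iff split: nat.split)

lemma true_in_inst [simp]: "true_in H e (inst R a b c) \<longleftrightarrow>
    true_in H (case_nat (msub_tm e a) (case_nat (msub_tm e b) (\<lambda>_. msub_tm e c))) R"
  unfolding inst_def true_in_msub comp_case_nat ..

lemma sat_inst [simp]: "sat e (inst R a b c) \<longleftrightarrow>
    sat (case_nat (eval e a) (case_nat (eval e b) (\<lambda>_. eval e c))) R"
  unfolding inst_def sat_msub comp_case_nat ..

lemma bounded_inst: "bounded_fm R \<Longrightarrow> bounded_fm (inst R a b c)"
  unfolding inst_def by (rule bounded_fm_msub)

lemma fm_below_inst: "tm_below d a \<Longrightarrow> tm_below d b \<Longrightarrow> tm_below d c \<Longrightarrow> fm_below d (inst R a b c)"
  unfolding inst_def by (rule fm_below_msub) (auto split: nat.split)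

text \<open>For a relation \<open>R(w, s, x)\<close>, let \<open>s\<close> be a solution for \<open>x\<close> if \<open>R(w, s, x)\<close> holds for all \<open>w\<close>.
  With the variables \<open>0, \<dots>, 5\<close> standing for \<open>w, b, s, y, x, n\<close>, the formula \<open>\<forall>w. least_fm R\<close> says that
  \<open>s\<close> is the least solution for \<open>x\<close>, and that \<open>b\<close> bounds the failures of all smaller candidates. With
  \<open>b\<close> as a parameter, \<open>least_fm R\<close> is bounded, and \<open>\<forall>w\<close> is the only unbounded quantifier.\<close>

definition least_fm :: "fm \<Rightarrow> fm" where
  "least_fm R = And (BAll (Var 2) (BEx (Var 2) (Neg (inst R (Var 0) (Var 1) (Var 6)))))
                    (inst R (Var 0) (Var 2) (Var 4))"

definition odd_fm :: "tm \<Rightarrow> fm" where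
  "odd_fm t = BEx t (Eq (up t) (Succ (Plus (Var 0) (Var 0))))"

definition val_fm :: "nat \<Rightarrow> nat \<Rightarrow> fm" where
  "val_fm k l = Or (And (Eq (Var 3) (num k)) (odd_fm (Var 2)))
                   (And (Eq (Var 3) (num l)) (Neg (odd_fm (Var 2))))"

text \<open>Two definitions of \<open>y\<close> as the value selected by the least solution for \<open>x\<close>: ``some least
  solution has the value \<open>y\<close>'' is \<open>\<Sigma>\<^sub>2\<close>, and ``every least solution has the value \<open>y\<close>'' is \<open>\<Pi>\<^sub>2\<close>.
  They agree as soon as there is exactly one least solution.\<close>

definition select_fm :: "nat \<Rightarrow> nat \<Rightarrow> fm \<Rightarrow> fm" where
  "select_fm k l R = Ex (Ex (All (And (least_fm R) (val_fm k l))))"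

definition select_Pi_fm :: "nat \<Rightarrow> nat \<Rightarrow> fm \<Rightarrow> fm" where
  "select_Pi_fm k l R = All (All (Ex (Imp (least_fm R) (val_fm k l))))"

context
  fixes H assumes H: "henkin H"
begin

context
  fixes R :: fm and x :: tm
begin

definition "solved w s \<longleftrightarrow> true_in H (case_nat w (case_nat s (\<lambda>_. x))) R"

definition "least_solution s b \<longleftrightarrow>
  (\<forall>t. Less t s \<in> H \<longrightarrow> (\<exists>w. Less w b \<in> H \<and> \<not> solved w t)) \<and> (\<forall>w. solved w s)"

text \<open>If there were no least solution, induction on \<open>s\<close> would show that all candidates below \<open>s\<close> fail
  before a common bound \<open>b\<close>, and in particular that \<open>t\<close> fails. A single induction thus provides
  both the least number principle and the \<open>\<Sigma>\<^sub>1\<close> collection that produces \<open>b\<close>.\<close>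

lemma least_solution_exists:
  assumes "\<forall>w. solved w t"
  shows "\<exists>s b. least_solution s b"
proof (rule ccontr)
  assume no: "\<nexists>s b. least_solution s b"
  let ?\<psi> = "Ex (BAll (Var 1) (BEx (Var 1) (Neg (inst R (Var 0) (Var 1) (Var 4)))))"
  have \<psi>: "true_in H (case_nat s (\<lambda>_. x)) ?\<psi> \<longleftrightarrow>
      (\<exists>b. \<forall>t. Less t s \<in> H \<longrightarrow> (\<exists>w. Less w b \<in> H \<and> \<not> solved w t))" for s
    using H by (simp add: solved_def eval_nat_numeral)
  have "true_in H (case_nat (Succ t) (\<lambda>_. x)) ?\<psi>"
  proof (rule true_in_induct[OF H])
    show "true_in H (case_nat Zero (\<lambda>_. x)) ?\<psi>"
      unfolding \<psi> using less_Zero[OF H] by blast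
  next
    fix s assume "true_in H (case_nat s (\<lambda>_. x)) ?\<psi>"
    then obtain b where b: "\<forall>t. Less t s \<in> H \<longrightarrow> (\<exists>w. Less w b \<in> H \<and> \<not> solved w t)"
      unfolding \<psi> by blast
    \<comment> \<open>otherwise \<open>s\<close> would be a least solution, with the bound \<open>b\<close>\<close>
    with no obtain w where w: "\<not> solved w s" unfolding least_solution_def by blast
    obtain m where m: "\<forall>z. Less z b \<in> H \<longrightarrow> Less z m \<in> H" "Less w m \<in> H"
      using upper_bound[OF H] by blast
    have "\<exists>w. Less w m \<in> H \<and> \<not> solved w t" if "Eq t s \<in> H" for t
    proof -
      have "\<not> solved w t"
        using true_in_Leibniz[OF H that, of "case_nat w (\<lambda>_. x)" "inst R (Var 1) (Var 0) (Var 2)"] w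
        by (auto simp: solved_def numeral_2_eq_2)
      with m(2) show ?thesis by blast
    qed
    with b m show "true_in H (case_nat (Succ s) (\<lambda>_. x)) ?\<psi>"
      unfolding \<psi> less_Succ[OF H] by blast
  qed
  then show False
    using assms unfolding \<psi> less_Succ[OF H] using eq_refl[OF H] by blast
qed

lemma least_solution_unique: "least_solution s b \<Longrightarrow> least_solution s' b' \<Longrightarrow> Eq s s' \<in> H"
  using less_linear[OF H, of s s'] unfolding least_solution_def by blast

end

definition "chosen_value k l y s \<longleftrightarrow>
  Eq y (num k) \<in> H \<and> true_in H (\<lambda>_. s) (odd_fm (Var 0)) \<or>
  Eq y (num l) \<in> H \<and> \<not> true_in H (\<lambda>_. s) (odd_fm (Var 0))"

lemma true_in_odd_fm: "true_in H e (odd_fm t) \<longleftrightarrow> true_in H (\<lambda>_. msub_tm e t) (odd_fm (Var 0))"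
  using H by (simp add: odd_fm_def msub_tm_up)

lemma odd_cong: 
  assumes "Eq s s' \<in> H"
  shows "true_in H (\<lambda>_. s) (odd_fm (Var 0)) \<longleftrightarrow> true_in H (\<lambda>_. s') (odd_fm (Var 0))"
  using true_in_Leibniz[OF H assms, of Var "odd_fm (Var 0)"]
    true_in_Leibniz[OF H eq_sym[OF H assms], of Var "odd_fm (Var 0)"]
  unfolding true_in_odd_fm[of "case_nat _ _"] by auto

lemma true_in_least_val:
  "true_in H (case_nat w (case_nat b (case_nat s e))) (least_fm R) \<longleftrightarrow>
     (\<forall>t. Less t s \<in> H \<longrightarrow> (\<exists>w. Less w b \<in> H \<and> \<not> solved R (e 1) w t)) \<and> solved R (e 1) w s"
  "true_in H (case_nat w (case_nat b (case_nat s e))) (val_fm k l) \<longleftrightarrow> chosen_value k l (e 0) s"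
  using H true_in_odd_fm[of "case_nat w (case_nat b (case_nat s e))" "Var 2"]
  by (simp_all add: least_fm_def val_fm_def chosen_value_def solved_def eval_nat_numeral)

lemma true_in_select_fm:
  "true_in H e (select_fm k l R) \<longleftrightarrow> (\<exists>s b. least_solution R (e 1) s b \<and> chosen_value k l (e 0) s)"
  "true_in H e (select_Pi_fm k l R) \<longleftrightarrow> (\<forall>s b. least_solution R (e 1) s b \<longrightarrow> chosen_value k l (e 0) s)"
  using H by (auto simp: select_fm_def select_Pi_fm_def true_in_least_val least_solution_def)

lemma true_in_select_total:
  assumes "\<And>x. \<exists>t. \<forall>w. true_in H (case_nat w (case_nat t (\<lambda>_. x))) R"
  shows "\<exists>s. \<forall>y. (true_in H (case_nat y e) (select_fm k l R) \<longleftrightarrow> chosen_value k l y s) \<and>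
                 (true_in H (case_nat y e) (select_Pi_fm k l R) \<longleftrightarrow> chosen_value k l y s)"
proof -
  obtain s b where s: "least_solution R (e 0) s b"
    using least_solution_exists[of R "e 0"] assms unfolding solved_def by blast
  have "chosen_value k l y s' \<longleftrightarrow> chosen_value k l y s" if "least_solution R (e 0) s' b'" for y s' b'
    using odd_cong[OF least_solution_unique[OF s that]] by (simp add: chosen_value_def)
  then have "(\<exists>s b. least_solution R (e 0) s b \<and> chosen_value k l y s) \<longleftrightarrow> chosen_value k l y s"
    "(\<forall>s b. least_solution R (e 0) s b \<longrightarrow> chosen_value k l y s) \<longleftrightarrow> chosen_value k l y s" for y
    using s by blast+
  then show ?thesis by (intro exI[of _ s]) (simp add: true_in_select_fm)
qed

end

text \<open>The hypothesis is that every \<open>x\<close> has some solution in every Henkin set, which holds for trivial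
  reasons in the application. Everything else is proved in \<open>PA\<close> for arbitrary \<open>R\<close>.\<close>

lemma PA_select_fm:
  assumes "\<And>H x. henkin H \<Longrightarrow> \<exists>t. \<forall>w. true_in H (case_nat w (case_nat t (\<lambda>_. x))) R"
  shows "PA_proves (Iff (select_fm k l R) (select_Pi_fm k l R))" "PA_proves (Ex1 (select_fm k l R))"
proof -
  show "PA_proves (Iff (select_fm k l R) (select_Pi_fm k l R))"
  proof (rule PA_provesI)
    fix H and e :: "nat \<Rightarrow> tm" assume H: "henkin H"
    have "case_nat (e 0) (\<lambda>i. e (Suc i)) = e" by (auto simp: fun_eq_iff split: nat.split)
    with true_in_select_total[OF H assms[OF H], of "\<lambda>i. e (Suc i)" k l]
    show "true_in H e (Iff (select_fm k l R) (select_Pi_fm k l R))"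
      unfolding true_in_connectives[OF H] by metis
  qed
  show "PA_proves (Ex1 (select_fm k l R))"
  proof (rule PA_provesI)
    fix H and e :: "nat \<Rightarrow> tm" assume H: "henkin H"
    obtain s where s: "\<forall>y. true_in H (case_nat y e) (select_fm k l R) \<longleftrightarrow> chosen_value H k l y s"
      using true_in_select_total[OF H assms[OF H], of e k l] by blast
    have "\<exists>y. \<forall>z. chosen_value H k l z s \<longleftrightarrow> Eq z y \<in> H"
      unfolding chosen_value_def[OF H] by metis
    then show "true_in H e (Ex1 (select_fm k l R))"
      unfolding Ex1_def true_in_connectives[OF H] true_in_lift_1 by (simp add: s)
  qed
qed

lemma Delta_select_fm:
  assumes "\<And>H x. henkin H \<Longrightarrow> \<exists>t. \<forall>w. true_in H (case_nat w (case_nat t (\<lambda>_. x))) R" and "bounded_fm R"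
  shows "Delta_fm 2 (select_fm k l R)"
proof -
  have b: "bounded_fm (least_fm R)" "bounded_fm (val_fm k l)"
    unfolding least_fm_def val_fm_def odd_fm_def by (intro bounded_fm_intros bounded_inst assms(2))+
  have "Sigma_fm 2 (select_fm k l R)"
  proof -
    have "select_fm k l R = (Ex ^^ 2) ((All ^^ 1) (And (least_fm R) (val_fm k l)))"
      by (simp add: select_fm_def numeral_2_eq_2)
    moreover have "bounded_fm (And (least_fm R) (val_fm k l))" using b by blast
    ultimately show ?thesis by (simp only: numeral_2_eq_2 Sigma_fm.simps Pi_fm.simps) blast
  qed
  moreover have "Pi_fm 2 (select_Pi_fm k l R)"
  proof -
    have "select_Pi_fm k l R = (All ^^ 2) ((Ex ^^ 1) (Imp (least_fm R) (val_fm k l)))"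
      by (simp add: select_Pi_fm_def numeral_2_eq_2)
    moreover have "bounded_fm (Imp (least_fm R) (val_fm k l))" using b by blast
    ultimately show ?thesis by (simp only: numeral_2_eq_2 Sigma_fm.simps Pi_fm.simps) blast
  qed
  moreover have "PA_proves (Iff (select_fm k l R) (select_fm k l R))"
    by (rule PA_provesI) simp
  ultimately show ?thesis
    using PA_select_fm(1)[OF assms(1)] by (auto simp: numeral_2_eq_2 simp del: Sigma_fm.simps Pi_fm.simps)
qed

lemma tm_below_num: "tm_below d (num n)"
  by (induction n) auto

lemma fm_below_select_fm: "fm_below 3 (select_fm k l R)"
  by (simp add: select_fm_def least_fm_def val_fm_def odd_fm_def fm_below_inst tm_below_num)

lemma sat_odd_fm: "sat e (odd_fm t) \<longleftrightarrow> odd (eval e t)"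
proof -
  have "odd n \<longleftrightarrow> (\<exists>q<n. n = Suc (q + q))" for n
    by (auto elim!: oddE intro: exI[of _ "n div 2"])
  then show ?thesis by (simp add: odd_fm_def)
qed

text \<open>In the standard model the bound on the failures of finitely many candidates always exists, so
  the formula speaks about the least solution.\<close>

lemma sat_select_fm:
  assumes "\<forall>w. sat (case_nat w (case_nat t (\<lambda>_. e 1))) R"
  shows "sat e (select_fm k l R) \<longleftrightarrow>
    e 0 = (if odd (LEAST t. \<forall>w. sat (case_nat w (case_nat t (\<lambda>_. e 1))) R) then k else l)"
proof -
  define Q where "Q w t = sat (case_nat w (case_nat t (\<lambda>_. e 1))) R" for w t
  define m where "m = (LEAST t. \<forall>w. Q w t)"
  have m: "\<forall>w. Q w m" using assms LeastI[of "\<lambda>t. \<forall>w. Q w t" t] by (simp add: m_def Q_def)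
  have below: "\<forall>t<m. \<exists>w. \<not> Q w t" using not_less_Least unfolding m_def by blast
  have "\<exists>b. \<forall>t<m. \<exists>w<b. \<not> Q w t"
  proof -
    from below obtain f where f: "\<forall>t<m. \<not> Q (f t) t" by metis
    have "f t < Suc (Max (f ` {..<m}))" if "t < m" for t using that by (simp add: less_Suc_eq_le)
    with f show ?thesis by blast
  qed
  moreover have "s = m" if "\<forall>w. Q w s" "\<forall>t<s. \<exists>w<b. \<not> Q w t" for s b
    using that m below by (cases s m rule: linorder_cases) blast+
  ultimately have *: "(\<exists>s b. (\<forall>t<s. \<exists>w<b. \<not> Q w t) \<and> (\<forall>w. Q w s) \<and> A s) \<longleftrightarrow> A m" for A
    using m by metis
  have "sat e (select_fm k l R) \<longleftrightarrow> (\<exists>s b. (\<forall>t<s. \<exists>w<b. \<not> Q w t) \<and> (\<forall>w. Q w s) \<and>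
      e 0 = (if odd s then k else l))"
    by (auto simp: select_fm_def least_fm_def val_fm_def sat_odd_fm Q_def eval_nat_numeral)
  then show ?thesis unfolding * by (simp add: m_def Q_def)
qed

section \<open>Clauses over codes\<close>

text \<open>A pattern denotes a number that depends on a valuation: the value of a term or the code of a
  pair. Pairs are separate from terms because \<open>prod_encode\<close> divides by 2 and is not the value of a
  term of the language.\<close>

datatype pat = PT tm | PP pat pat

fun pval :: "(nat \<Rightarrow> nat) \<Rightarrow> pat \<Rightarrow> nat" where
  "pval v (PT t) = eval v t"
| "pval v (PP p q) = prod_encode (pval v p, pval v q)"

fun pat_below :: "nat \<Rightarrow> pat \<Rightarrow> bool" where
  "pat_below d (PT t) \<longleftrightarrow> tm_below d t"
| "pat_below d (PP p q) \<longleftrightarrow> pat_below d p \<and> pat_below d q"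

text \<open>A clause says that if all patterns of the first list are members of a set, then so is some
  pattern of the second list. An empty second list makes it a prohibition.\<close>

type_synonym clause = "pat list \<times> pat list"

definition satisfies :: "nat set \<Rightarrow> clause \<Rightarrow> bool" where
  "satisfies X cl \<longleftrightarrow>
     (\<forall>v. (\<forall>p\<in>set (fst cl). pval v p \<in> X) \<longrightarrow> (\<exists>q\<in>set (snd cl). pval v q \<in> X))"

text \<open>The part of a clause that concerns numbers below \<open>n\<close>. A conclusion beyond \<open>n\<close> counts as
  satisfied, which makes the condition weaker for smaller \<open>n\<close> and dependent only on
  \<open>X \<inter> {..<n}\<close>. The clause has the variables \<open>0, \<dots>, m - 1\<close>.\<close>

definition satisfies_below :: "nat \<Rightarrow> nat \<Rightarrow> nat set \<Rightarrow> clause \<Rightarrow> bool" where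
  "satisfies_below m n X cl \<longleftrightarrow>
     (\<forall>v. (\<forall>i<m. v i < n) \<longrightarrow> (\<forall>p\<in>set (fst cl). pval v p < n \<and> pval v p \<in> X) \<longrightarrow>
       (\<exists>q\<in>set (snd cl). pval v q < n \<longrightarrow> pval v q \<in> X))"

definition clause_below :: "nat \<Rightarrow> clause \<Rightarrow> bool" where
  "clause_below m cl \<longleftrightarrow> (\<forall>p\<in>set (fst cl) \<union> set (snd cl). pat_below m p)"

lemma eval_cong: "tm_below d t \<Longrightarrow> (\<And>i. i < d \<Longrightarrow> v i = w i) \<Longrightarrow> eval v t = eval w t"
  by (induction t) auto

lemma pval_cong: "pat_below d p \<Longrightarrow> (\<And>i. i < d \<Longrightarrow> v i = w i) \<Longrightarrow> pval v p = pval w p"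
  by (induction p) (auto intro: eval_cong)

lemma satisfies_imp_below: "satisfies X cl \<Longrightarrow> satisfies_below m n X cl"
  unfolding satisfies_def satisfies_below_def by blast

lemma satisfies_below_mono:
  assumes "satisfies_below m n X cl" "n' \<le> n"
  shows "satisfies_below m n' X cl"
  unfolding satisfies_below_def
proof (intro allI impI)
  fix v assume "\<forall>i<m. v i < n'" "\<forall>p\<in>set (fst cl). pval v p < n' \<and> pval v p \<in> X"
  then have "\<forall>i<m. v i < n" "\<forall>p\<in>set (fst cl). pval v p < n \<and> pval v p \<in> X"
    using assms(2) by (auto intro: less_le_trans)
  then obtain q where "q \<in> set (snd cl)" "pval v q < n \<longrightarrow> pval v q \<in> X"
    using assms(1) unfolding satisfies_below_def by blast
  then show "\<exists>q\<in>set (snd cl). pval v q < n' \<longrightarrow> pval v q \<in> X"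
    using assms(2) by (auto intro: less_le_trans)
qed

lemma satisfies_below_cong:
  assumes "X \<inter> {..<n} = Y \<inter> {..<n}"
  shows "satisfies_below m n X cl \<longleftrightarrow> satisfies_below m n Y cl"
proof -
  have "k < n \<Longrightarrow> k \<in> X \<longleftrightarrow> k \<in> Y" for k using assms by blast
  then have "k < n \<and> k \<in> X \<longleftrightarrow> k < n \<and> k \<in> Y" "(k < n \<longrightarrow> k \<in> X) \<longleftrightarrow> (k < n \<longrightarrow> k \<in> Y)" for k by auto
  then show ?thesis unfolding satisfies_below_def by simp
qed

section \<open>The leftmost path\<close>

context
  fixes m :: nat and cls :: "clause list"
begin

text \<open>The number \<open>\<sigma>\<close> codes the restriction of \<open>X\<close> to \<open>{0..c}\<close>, with the membership of \<open>0\<close> as its most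
  significant bit. So the numerical order of the codes is the lexicographic order, halving a code
  removes the last decision, and the parity of \<open>\<sigma>\<close> is the decision about \<open>c\<close>.\<close>

definition prefix :: "nat \<Rightarrow> nat \<Rightarrow> nat set \<Rightarrow> bool" where
  "prefix c \<sigma> X \<longleftrightarrow> (\<forall>i\<le>c. i \<in> X \<longleftrightarrow> c - i \<in> set_decode \<sigma>)"

definition extendible :: "nat \<Rightarrow> nat \<Rightarrow> nat \<Rightarrow> bool" where
  "extendible n \<sigma> c \<longleftrightarrow> (\<exists>X. prefix c \<sigma> X \<and> (\<forall>cl\<in>set cls. satisfies_below m n X cl))"

text \<open>The exception for \<open>2 ^ Suc c\<close>, which exceeds all codes of restrictions to \<open>{0..c}\<close>, provides a
  solution that \<open>PA\<close> recognizes without knowing that the tree is infinite.\<close>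

definition leftmost :: "nat \<Rightarrow> nat" where
  "leftmost c = (LEAST \<sigma>. \<forall>n. extendible n \<sigma> c \<or> \<sigma> = 2 ^ Suc c)"

definition path :: "nat set" where
  "path = {c. odd (leftmost c)}"

lemma prefix_Suc:
  "prefix (Suc c) \<sigma> X \<longleftrightarrow> prefix c (\<sigma> div 2) X \<and> (Suc c \<in> X \<longleftrightarrow> odd \<sigma>)"
  by (auto simp: prefix_def le_Suc_eq Suc_diff_le set_decode_0 set_decode_Suc simp del: set_decode_zero)

lemma extendible_mono: "extendible n \<sigma> c \<Longrightarrow> n' \<le> n \<Longrightarrow> extendible n' \<sigma> c"
  unfolding extendible_def using satisfies_below_mono by blast

lemma extendible_div_2: "extendible n \<sigma> (Suc c) \<Longrightarrow> extendible n (\<sigma> div 2) c"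
  unfolding extendible_def prefix_Suc by blast

text \<open>Koenig's lemma for one step: if both extensions of \<open>\<sigma>\<close> failed, at \<open>n0\<close> and at \<open>n1\<close>, then \<open>\<sigma>\<close>
  itself would fail at \<open>max n0 n1\<close>.\<close>

lemma extendible_Suc:
  assumes "\<forall>n. extendible n \<sigma> c"
  shows "\<exists>\<tau>. \<tau> div 2 = \<sigma> \<and> (\<forall>n. extendible n \<tau> (Suc c))"
proof (rule ccontr)
  assume "\<not> ?thesis"
  then obtain n0 n1 where n: "\<not> extendible n0 (2 * \<sigma>) (Suc c)" "\<not> extendible n1 (2 * \<sigma> + 1) (Suc c)"
    by (metis div_mult_self1_is_m nonzero_mult_div_cancel_left zero_less_numeral 
        Suc_eq_plus1 even_Suc_div_two even_mult_iff even_numeral zero_neq_numeral)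
  have "extendible (max n0 n1) \<sigma> c" using assms by blast
  then obtain X where X: "prefix c \<sigma> X" "\<forall>cl\<in>set cls. satisfies_below m (max n0 n1) X cl"
    unfolding extendible_def by blast
  have "prefix (Suc c) (2 * \<sigma>) X \<or> prefix (Suc c) (2 * \<sigma> + 1) X"
    using X(1) by (simp add: prefix_Suc)
  with X(2) have "extendible (max n0 n1) (2 * \<sigma>) (Suc c) \<or> extendible (max n0 n1) (2 * \<sigma> + 1) (Suc c)"
    unfolding extendible_def by blast
  with n show False using extendible_mono by (meson max.cobounded1 max.cobounded2)
qed

lemma set_encode_less: "A \<subseteq> {..<k} \<Longrightarrow> set_encode A < 2 ^ k"
proof -
  assume "A \<subseteq> {..<k}"
  then have "set_encode A \<le> (\<Sum>i<k. 2 ^ i)"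
    unfolding set_encode_def by (intro sum_mono2) auto
  also have "\<dots> < 2 ^ k" by (induction k) auto
  finally show ?thesis .
qed

context
  fixes X0 assumes X0: "\<And>cl. cl \<in> set cls \<Longrightarrow> satisfies X0 cl"
begin

lemma extendible_exists: "\<exists>\<sigma><2 ^ Suc c. \<forall>n. extendible n \<sigma> c"
proof (intro exI conjI allI)
  let ?A = "{j. j \<le> c \<and> c - j \<in> X0}"
  show "set_encode ?A < 2 ^ Suc c" by (rule set_encode_less) auto
  have "finite ?A" by simp
  then have "prefix c (set_encode ?A) X0" by (simp add: prefix_def)
  then show "extendible n (set_encode ?A) c" for n
    using X0 satisfies_imp_below unfolding extendible_def by blast
qed

lemma leftmost_eq: "leftmost c = (LEAST \<sigma>. \<forall>n. extendible n \<sigma> c)"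
  and extendible_leftmost: "extendible n (leftmost c) c"
proof -
  define l where "l = (LEAST \<sigma>. \<forall>n. extendible n \<sigma> c)"
  obtain \<sigma> where \<sigma>: "\<sigma> < 2 ^ Suc c" "\<forall>n. extendible n \<sigma> c" using extendible_exists by blast
  have l: "\<forall>n. extendible n l c" unfolding l_def by (rule LeastI) (rule \<sigma>(2))
  have "l \<le> \<tau>" if "\<forall>n. extendible n \<tau> c" for \<tau> unfolding l_def using that by (rule Least_le)
  moreover from this[OF \<sigma>(2)] have "l < 2 ^ Suc c" using \<sigma>(1) by simp
  ultimately have "leftmost c = l"
    unfolding leftmost_def using l by (intro Least_equality) (auto intro: less_imp_le)
  with l show "leftmost c = (LEAST \<sigma>. \<forall>n. extendible n \<sigma> c)" "extendible n (leftmost c) c"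
    by (simp_all add: l_def)
qed

lemma leftmost_le: "\<forall>n. extendible n \<sigma> c \<Longrightarrow> leftmost c \<le> \<sigma>"
  unfolding leftmost_eq by (rule Least_le)

text \<open>The leftmost nodes of the successive levels lie on one path: truncation preserves
  extendibility and the order, and the leftmost node has an extendible successor.\<close>

lemma leftmost_Suc_div_2: "leftmost (Suc c) div 2 = leftmost c"
proof (rule antisym)
  obtain \<tau> where "\<tau> div 2 = leftmost c" "\<forall>n. extendible n \<tau> (Suc c)"
    using extendible_Suc extendible_leftmost by blast
  then show "leftmost (Suc c) div 2 \<le> leftmost c"
    using leftmost_le div_le_mono by metis
  show "leftmost c \<le> leftmost (Suc c) div 2"
    using extendible_leftmost extendible_div_2 by (blast intro: leftmost_le)
qed

lemma prefix_leftmost_path: "prefix c (leftmost c) path"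
proof (induction c)
  case 0
  then show ?case by (simp add: prefix_def path_def set_decode_0)
next
  case (Suc c)
  then show ?case by (simp add: prefix_Suc leftmost_Suc_div_2) (simp add: path_def)
qed

text \<open>An instance of a clause involves finitely many numbers. Choose \<open>n\<close> beyond them: the prefix of
  the path of length \<open>n + 1\<close> is extendible at \<open>n\<close>, and the set that witnesses this agrees with the
  path on all of these numbers.\<close>

lemma path_satisfies:
  assumes "cl \<in> set cls"
  shows "satisfies path cl"
  unfolding satisfies_def
proof (intro allI impI)
  fix v assume prems: "\<forall>p\<in>set (fst cl). pval v p \<in> path"
  let ?A = "v ` {..<m} \<union> pval v ` (set (fst cl) \<union> set (snd cl))"
  obtain n where n: "\<forall>k\<in>?A. k < n"
    using finite_nat_set_iff_bounded[of ?A] by blast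
  obtain X where X: "prefix n (leftmost n) X" "satisfies_below m n X cl"
    using extendible_leftmost[of n n] assms unfolding extendible_def by blast
  have eq: "k \<in> X \<longleftrightarrow> k \<in> path" if "k < n" for k
    using X(1) prefix_leftmost_path[of n] that by (simp add: prefix_def)
  have "\<forall>i<m. v i < n" "\<forall>p\<in>set (fst cl). pval v p < n \<and> pval v p \<in> X"
    using n prems eq by auto
  then obtain q where "q \<in> set (snd cl)" "pval v q < n \<longrightarrow> pval v q \<in> X"
    using X(2) unfolding satisfies_below_def by blast
  with n eq show "\<exists>q\<in>set (snd cl). pval v q \<in> path" by blast
qed

end

end

section \<open>The bounded formula\<close>

definition Bit_fm :: "tm \<Rightarrow> tm \<Rightarrow> fm" where
  "Bit_fm e w = BEx (Succ w) (BEx (Expt (num 2) (up e))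
     (Eq (up (up w)) (Plus (Times (Var 1) (Expt (num 2) (Succ (up (up e)))))
                           (Plus (Expt (num 2) (up (up e))) (Var 0)))))"

lemma sat_Bit_fm [simp]: "sat e (Bit_fm t w) \<longleftrightarrow> eval e t \<in> set_decode (eval e w)"
proof -
  have *: "(\<exists>q r. r < 2 ^ k \<and> n = q * 2 ^ Suc k + (2 ^ k + r)) \<longleftrightarrow>
      (\<exists>q<Suc n. \<exists>r<2 ^ k. n = q * 2 ^ Suc k + (2 ^ k + r))" for k n :: nat
  proof
    assume "\<exists>q r. r < 2 ^ k \<and> n = q * 2 ^ Suc k + (2 ^ k + r)"
    then obtain q r where qr: "r < 2 ^ k" "n = q * 2 ^ Suc k + (2 ^ k + r)" by blast
    have "q \<le> q * 2 ^ Suc k" by simp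
    with qr(2) have "q < Suc n" by linarith
    with qr show "\<exists>q<Suc n. \<exists>r<2 ^ k. n = q * 2 ^ Suc k + (2 ^ k + r)" by blast
  qed blast
  show ?thesis
    unfolding set_decode_def mem_Collect_eq odd_div_power_iff * by (simp add: Bit_fm_def)
qed

text \<open>Variable \<open>0\<close> is the value of the pattern, whose own variables are shifted by one. The
  components of a pair are bounded by its code, so bounded quantifiers suffice.\<close>

fun value_fm :: "pat \<Rightarrow> fm" where
  "value_fm (PT t) = Eq (Var 0) (up t)"
| "value_fm (PP p q) = BEx (Succ (Var 0)) (BEx (Succ (Var 1)) (And (Pair_fm (Var 1) (Var 0) (Var 2))
     (And (msub (case_nat (Var 1) (\<lambda>i. Var (i + 3))) (value_fm p))
          (msub (case_nat (Var 0) (\<lambda>i. Var (i + 3))) (value_fm q)))))"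

lemma sat_value_fm: "sat e (value_fm p) \<longleftrightarrow> e 0 = pval (\<lambda>i. e (Suc i)) p"
proof (induction p arbitrary: e)
  case (PT t)
  have "eval e (up t) = eval (\<lambda>i. e (Suc i)) t" for t by (induction t) auto
  then show ?case by simp
next
  case (PP p q)
  have "e 0 = prod_encode (a, b) \<Longrightarrow> a < Suc (e 0) \<and> b < Suc (e 0)" for a b
    by (simp add: prod_encode_bounds less_Suc_eq_le)
  then show ?case
    by (auto simp: sat_Pair_fm sat_msub PP.IH numeral_2_eq_2 numeral_3_eq_3)
qed

lemma bounded_value_fm: "bounded_fm (value_fm p)"
  by (induction p) (auto simp: Pair_fm_def intro!: bounded_fm_intros bounded_fm_msub)

fun conj_fm :: "fm list \<Rightarrow> fm" where
  "conj_fm [] = Eq Zero Zero"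
| "conj_fm (\<phi> # \<phi>s) = And \<phi> (conj_fm \<phi>s)"

fun disj_fm :: "fm list \<Rightarrow> fm" where
  "disj_fm [] = Neg (Eq Zero Zero)"
| "disj_fm (\<phi> # \<phi>s) = Or \<phi> (disj_fm \<phi>s)"

lemma sat_conj_fm [simp]: "sat e (conj_fm \<phi>s) \<longleftrightarrow> (\<forall>\<phi>\<in>set \<phi>s. sat e \<phi>)"
  by (induction \<phi>s) auto

lemma sat_disj_fm [simp]: "sat e (disj_fm \<phi>s) \<longleftrightarrow> (\<exists>\<phi>\<in>set \<phi>s. sat e \<phi>)"
  by (induction \<phi>s) auto

lemma bounded_conj_fm: "(\<And>\<phi>. \<phi> \<in> set \<phi>s \<Longrightarrow> bounded_fm \<phi>) \<Longrightarrow> bounded_fm (conj_fm \<phi>s)"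
  by (induction \<phi>s) (auto intro: bounded_fm_intros)

lemma bounded_disj_fm: "(\<And>\<phi>. \<phi> \<in> set \<phi>s \<Longrightarrow> bounded_fm \<phi>) \<Longrightarrow> bounded_fm (disj_fm \<phi>s)"
  by (induction \<phi>s) (auto intro: bounded_fm_intros)

text \<open>A block of \<open>m\<close> quantifiers bounded by the value of variable \<open>1\<close> outside the block, which is
  variable \<open>Suc j\<close> below \<open>j\<close> of the quantifiers.\<close>

fun balls :: "nat \<Rightarrow> fm \<Rightarrow> fm" where
  "balls 0 \<phi> = \<phi>"
| "balls (Suc m) \<phi> = balls m (BAll (Var (Suc m)) \<phi>)"

lemma bounded_balls: "bounded_fm \<phi> \<Longrightarrow> bounded_fm (balls m \<phi>)"
  by (induction m arbitrary: \<phi>) (auto intro: bounded_fm_intros)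

lemma sat_balls:
  "sat e (balls m \<phi>) \<longleftrightarrow> (\<forall>v. (\<forall>i<m. v i < e 1) \<longrightarrow> sat (\<lambda>i. if i < m then v i else e (i - m)) \<phi>)"
proof (induction m arbitrary: \<phi>)
  case (Suc m)
  have eq: "case_nat a (\<lambda>i. if i < m then v i else e (i - m)) =
      (\<lambda>i. if i < Suc m then case_nat a v i else e (i - Suc m))" for a v
    by (auto simp: fun_eq_iff split: nat.split)
  have "sat e (balls (Suc m) \<phi>) \<longleftrightarrow> (\<forall>v. (\<forall>i<m. v i < e 1) \<longrightarrow> (\<forall>a<e 1.
      sat (\<lambda>i. if i < Suc m then case_nat a v i else e (i - Suc m)) \<phi>))"
    by (simp add: Suc.IH eq)
  also have "\<dots> \<longleftrightarrow> (\<forall>v. (\<forall>i<Suc m. v i < e 1) \<longrightarrow> sat (\<lambda>i. if i < Suc m then v i else e (i - Suc m)) \<phi>)"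
    (is "?l \<longleftrightarrow> ?r")
  proof
    assume ?l
    show ?r
    proof (intro allI impI)
      fix v :: "nat \<Rightarrow> nat" assume v: "\<forall>i<Suc m. v i < e 1"
      have "case_nat (v 0) (\<lambda>i. v (Suc i)) = v" by (auto simp: fun_eq_iff split: nat.split)
      then show "sat (\<lambda>i. if i < Suc m then v i else e (i - Suc m)) \<phi>"
        using \<open>?l\<close>[rule_format, of "\<lambda>i. v (Suc i)" "v 0"] v by (simp only:)
    qed
  next
    assume ?r
    show ?l
    proof (intro allI impI)
      fix v a assume "\<forall>i<m. v i < e 1" "a < e 1"
      then have "\<forall>i<Suc m. case_nat a v i < e 1" by (auto split: nat.split)
      with \<open>?r\<close> show "sat (\<lambda>i. if i < Suc m then case_nat a v i else e (i - Suc m)) \<phi>" by blast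
    qed
  qed
  finally show ?case .
qed simp

text \<open>Outside the block of quantifiers, variable \<open>0\<close> is the code of the set and variable \<open>1\<close> is \<open>n\<close>.\<close>

definition clause_fm :: "nat \<Rightarrow> clause \<Rightarrow> fm" where
  "clause_fm m cl = balls m (Imp
     (conj_fm (map (\<lambda>p. BEx (Var (Suc m)) (And (value_fm p) (Bit_fm (Var 0) (Var (Suc m))))) (fst cl)))
     (disj_fm (map (\<lambda>q. BAll (Var (Suc m)) (Imp (value_fm q) (Bit_fm (Var 0) (Var (Suc m))))) (snd cl))))"

lemma sat_clause_fm:
  assumes "clause_below m cl"
  shows "sat e (clause_fm m cl) \<longleftrightarrow> satisfies_below m (e 1) (set_decode (e 0)) cl"
proof -
  have "pval (\<lambda>i. if i < m then v i else e (i - m)) p = pval v p"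
    if "p \<in> set (fst cl) \<union> set (snd cl)" for p v
    using assms that by (intro pval_cong[of m]) (auto simp: clause_below_def)
  then show ?thesis
    by (simp add: clause_fm_def sat_balls satisfies_below_def sat_value_fm)
qed

text \<open>The variables \<open>0\<close>, \<open>1\<close>, \<open>2\<close> are \<open>n\<close>, \<open>\<sigma>\<close>, \<open>c\<close>. To see whether \<open>\<sigma>\<close> is extendible at
  \<open>n\<close>, it is enough to search the subsets of \<open>{0..n + c}\<close>, whose codes are less than
  \<open>2 ^ Suc (n + c)\<close>.\<close>

definition tree_fm :: "nat \<Rightarrow> clause list \<Rightarrow> fm" where
  "tree_fm m cls = Or
     (BEx (Expt (num 2) (Succ (Plus (Var 0) (Var 2)))) (And
        (BAll (Succ (Var 3)) (BAll (Succ (Var 4)) (Imp (Eq (Plus (Var 1) (Var 0)) (Var 5))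
          (Iff (Bit_fm (Var 1) (Var 2)) (Bit_fm (Var 0) (Var 4))))))
        (conj_fm (map (clause_fm m) cls))))
     (Eq (Var 1) (Expt (num 2) (Succ (Var 2))))"

lemma bounded_tree_fm: "bounded_fm (tree_fm m cls)"
  unfolding tree_fm_def Iff_def Bit_fm_def
  by (intro bounded_fm_intros bounded_conj_fm)
    (auto simp: clause_fm_def Bit_fm_def
      intro!: bounded_balls bounded_conj_fm bounded_disj_fm bounded_value_fm bounded_fm_intros)

lemma sat_tree_fm:
  assumes "\<And>cl. cl \<in> set cls \<Longrightarrow> clause_below m cl"
  shows "sat e (tree_fm m cls) \<longleftrightarrow> extendible m cls (e 0) (e 1) (e 2) \<or> e 1 = 2 ^ Suc (e 2)"
proof -
  let ?n = "e 0" and ?\<sigma> = "e 1" and ?c = "e 2"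
  have pre: "(\<forall>i<Suc ?c. \<forall>j<Suc ?c. i + j = ?c \<longrightarrow> (i \<in> X \<longleftrightarrow> j \<in> set_decode ?\<sigma>)) \<longleftrightarrow> prefix ?c ?\<sigma> X" for X
  proof -
    have "i + j = ?c \<longleftrightarrow> j = ?c - i" if "i < Suc ?c" for i j using that by auto
    then show ?thesis by (auto simp: prefix_def less_Suc_eq_le)
  qed
  have "(\<exists>X<2 ^ Suc (?n + ?c). prefix ?c ?\<sigma> (set_decode X) \<and>
      (\<forall>cl\<in>set cls. satisfies_below m ?n (set_decode X) cl)) \<longleftrightarrow> extendible m cls ?n ?\<sigma> ?c" (is "?l \<longleftrightarrow> _")
  proof
    assume "extendible m cls ?n ?\<sigma> ?c"
    then obtain X where X: "prefix ?c ?\<sigma> X" "\<forall>cl\<in>set cls. satisfies_below m ?n X cl"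
      unfolding extendible_def by blast
    let ?Y = "X \<inter> {..<Suc (?n + ?c)}"
    have "set_decode (set_encode ?Y) = ?Y" by simp
    moreover have "prefix ?c ?\<sigma> ?Y" using X(1) by (auto simp: prefix_def)
    moreover have "\<forall>cl\<in>set cls. satisfies_below m ?n ?Y cl"
    proof -
      have "X \<inter> {..<?n} = ?Y \<inter> {..<?n}" by auto
      with X(2) satisfies_below_cong show ?thesis by blast
    qed
    moreover have "set_encode ?Y < 2 ^ Suc (?n + ?c)" by (rule set_encode_less) blast
    ultimately show ?l by metis
  qed (auto simp: extendible_def)
  moreover have "sat e (tree_fm m cls) \<longleftrightarrow> ?l \<or> ?\<sigma> = 2 ^ Suc ?c"
    using assms unfolding pre[symmetric]
    by (simp add: tree_fm_def Iff_def sat_clause_fm eval_nat_numeral flip: iff_conv_conj_imp)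
  ultimately show ?thesis by blast
qed

text \<open>The solution is the exceptional value \<open>2 ^ Suc c\<close>. This is all that has to be verified in \<open>PA\<close>
  about the tree, and so the correctness of the coding matters only in the standard model.\<close>

lemma PA_tree_fm:
  assumes "henkin H"
  shows "\<exists>t. \<forall>w. true_in H (case_nat w (case_nat t (\<lambda>_. x))) (tree_fm m cls)"
  by (rule exI[of _ "Expt (num 2) (Succ x)"])
    (simp add: tree_fm_def true_in_connectives[OF assms] eq_refl[OF assms] numeral_2_eq_2)

lemma sat_select_tree_fm:
  assumes "\<And>cl. cl \<in> set cls \<Longrightarrow> clause_below m cl"
  shows "sat e (select_fm k l (tree_fm m cls)) \<longleftrightarrow> e 0 = (if e 1 \<in> path m cls then k else l)"
proof -
  have *: "sat (case_nat n (case_nat \<sigma> (\<lambda>_. e 1))) (tree_fm m cls) \<longleftrightarrow>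
      extendible m cls n \<sigma> (e 1) \<or> \<sigma> = 2 ^ Suc (e 1)" for n \<sigma>
    using assms by (simp add: sat_tree_fm numeral_2_eq_2)
  have "\<forall>n. sat (case_nat n (case_nat (2 ^ Suc (e 1)) (\<lambda>_. e 1))) (tree_fm m cls)"
    unfolding * by simp
  then show ?thesis
    using sat_select_fm[of "2 ^ Suc (e 1)" e "tree_fm m cls" k l]
    by (simp only: * path_def leftmost_def mem_Collect_eq simp_thms)
qed

section \<open>Peano arithmetic as a list of clauses\<close>

abbreviation pair_code :: "nat \<Rightarrow> nat \<Rightarrow> nat" ("\<langle>_, _\<rangle>")
  where "\<langle>a, b\<rangle> \<equiv> prod_encode (a, b)"

text \<open>The syntactic operations of the calculus: lifting and substitution, at some depth of binding.
  Both act in the same way on everything but variables, so they share their clauses.\<close>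

datatype sop = Lift nat | Sub nat tm

fun bind_op :: "sop \<Rightarrow> sop" where
  "bind_op (Lift k) = Lift (Suc k)"
| "bind_op (Sub k u) = Sub (Suc k) (up u)"

fun op_tm :: "sop \<Rightarrow> tm \<Rightarrow> tm" where
  "op_tm (Lift k) t = lift_tm k t"
| "op_tm (Sub k u) t = subst_tm k u t"

fun op_fm :: "sop \<Rightarrow> fm \<Rightarrow> fm" where
  "op_fm (Lift k) \<phi> = lift_fm k \<phi>"
| "op_fm (Sub k u) \<phi> = subst_fm k u \<phi>"

fun op_code :: "sop \<Rightarrow> nat" where
  "op_code (Lift k) = \<langle>0, k\<rangle>"
| "op_code (Sub k u) = \<langle>1, \<langle>k, tm_code u\<rangle>\<rangle>"

lemma op_tm_simps [simp]:
  "op_tm s Zero = Zero" "op_tm s (Succ t) = Succ (op_tm s t)"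
  "op_tm s (Plus t u) = Plus (op_tm s t) (op_tm s u)"
  "op_tm s (Times t u) = Times (op_tm s t) (op_tm s u)"
  "op_tm s (Expt t u) = Expt (op_tm s t) (op_tm s u)"
  by (cases s; simp)+

lemma op_fm_simps [simp]:
  "op_fm s (Eq t u) = Eq (op_tm s t) (op_tm s u)" "op_fm s (Less t u) = Less (op_tm s t) (op_tm s u)"
  "op_fm s (Neg \<phi>) = Neg (op_fm s \<phi>)" "op_fm s (And \<phi> \<psi>) = And (op_fm s \<phi>) (op_fm s \<psi>)"
  "op_fm s (Or \<phi> \<psi>) = Or (op_fm s \<phi>) (op_fm s \<psi>)"
  "op_fm s (Imp \<phi> \<psi>) = Imp (op_fm s \<phi>) (op_fm s \<psi>)"
  "op_fm s (All \<phi>) = All (op_fm (bind_op s) \<phi>)" "op_fm s (Ex \<phi>) = Ex (op_fm (bind_op s) \<phi>)"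
  by (cases s; simp)+

lemma code_eq_iff [simp]:
  "tm_code t = tm_code u \<longleftrightarrow> t = u" "fm_code \<phi> = fm_code \<psi> \<longleftrightarrow> \<phi> = \<psi>"
  by (simp_all add: inj_eq inj_tm_code inj_fm_code)

lemma op_code_eq_iff [simp]: "op_code s = op_code r \<longleftrightarrow> s = r"
  by (cases s; cases r) auto

text \<open>The sets described by the clauses contain items of the following kinds, told apart by the tag
  in their first component:
  \<^item> a number with a tag below 8 stands for a formula with this code that is accepted as true;
  \<^item> \<open>\<langle>8, a\<rangle>\<close>: the formula with code \<open>a\<close> is provable;
  \<^item> \<open>\<langle>9, \<langle>s, \<langle>a, b\<rangle>\<rangle>\<rangle>\<close> and \<open>\<langle>10, \<langle>s, \<langle>a, b\<rangle>\<rangle>\<rangle>\<close>: the operation \<open>s\<close> turns the term or formula \<open>a\<close> into \<open>b\<close>;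
  \<^item> \<open>\<langle>11, \<langle>s, r\<rangle>\<rangle>\<close>: below a quantifier, the operation \<open>s\<close> becomes \<open>r\<close>;
  \<^item> \<open>\<langle>12, a\<rangle>\<close>: \<open>a\<close> is the code of a formula.

  The items of the other kinds are closed under rules, so a set that satisfies the clauses contains all correct ones. It may contain
  incorrect ones too, but the clauses for the first kind keep it from being contradictory.\<close>

abbreviation "pv i \<equiv> PT (Var i)"
abbreviation "pc n \<equiv> PT (num n)"
abbreviation "punary k a \<equiv> PP (pc k) a"
abbreviation "pbinary k a b \<equiv> PP (pc k) (PP a b)"
abbreviation "pvar t \<equiv> punary 0 (PT t)"
abbreviation "plift t \<equiv> PP (pc 0) (PT t)"
abbreviation "psub t u \<equiv> PP (pc 1) (PP (PT t) u)"
abbreviation "pProv a \<equiv> PP (pc 8) a"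
abbreviation "pTm s a b \<equiv> PP (pc 9) (PP s (PP a b))"
abbreviation "pFm s a b \<equiv> PP (pc 10) (PP s (PP a b))"
abbreviation "pBind s r \<equiv> PP (pc 11) (PP s r)"
abbreviation "pEq \<equiv> pbinary 0"
abbreviation "pNeg \<equiv> punary 2"
abbreviation "pAnd \<equiv> pbinary 3"
abbreviation "pOr \<equiv> pbinary 4"
abbreviation "pImp \<equiv> pbinary 5"
abbreviation "pAll \<equiv> punary 6"
abbreviation "pEx \<equiv> punary 7"
abbreviation "pTmCode t \<equiv> pc (tm_code t)"

text \<open>The recursion equations of the operations, read as closure rules. A case distinction \<open>i < k\<close> on
  a variable is expressed by writing \<open>k\<close> as \<open>Suc (i + j)\<close>. Premises with \<open>pBind\<close> make sure that the
  first argument is the code of an operation.\<close>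

definition op_clauses :: "clause list" where
  "op_clauses =
    [([], [pBind (plift (Var 0)) (plift (Succ (Var 0)))]),
     ([pTm (plift Zero) (pv 1) (pv 2)], [pBind (psub (Var 0) (pv 1)) (psub (Succ (Var 0)) (pv 2))]),
     ([], [pTm (plift (Succ (Plus (Var 0) (Var 1)))) (pvar (Var 0)) (pvar (Var 0))]),
     ([], [pTm (plift (Var 0)) (pvar (Plus (Var 0) (Var 1))) (pvar (Succ (Plus (Var 0) (Var 1))))]),
     ([pBind (psub (Succ (Plus (Var 0) (Var 1))) (pv 2)) (pv 3)],
        [pTm (psub (Succ (Plus (Var 0) (Var 1))) (pv 2)) (pvar (Var 0)) (pvar (Var 0))]),
     ([pBind (psub (Var 0) (pv 1)) (pv 2)], [pTm (psub (Var 0) (pv 1)) (pvar (Var 0)) (pv 1)]),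
     ([pBind (psub (Var 0) (pv 1)) (pv 2)],
        [pTm (psub (Var 0) (pv 1)) (pvar (Succ (Plus (Var 0) (Var 3)))) (pvar (Plus (Var 0) (Var 3)))]),
     ([pBind (pv 0) (pv 1)], [pTm (pv 0) (pTmCode Zero) (pTmCode Zero)]),
     ([pTm (pv 0) (pv 1) (pv 2)], [pTm (pv 0) (punary 2 (pv 1)) (punary 2 (pv 2))])] @
    map (\<lambda>k. ([pTm (pv 0) (pv 1) (pv 2), pTm (pv 0) (pv 3) (pv 4)],
              [pTm (pv 0) (pbinary k (pv 1) (pv 3)) (pbinary k (pv 2) (pv 4))])) [3, 4, 5] @
    map (\<lambda>k. ([pTm (pv 0) (pv 1) (pv 2), pTm (pv 0) (pv 3) (pv 4)],
              [pFm (pv 0) (pbinary k (pv 1) (pv 3)) (pbinary k (pv 2) (pv 4))])) [0, 1] @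
    [([pFm (pv 0) (pv 1) (pv 2)], [pFm (pv 0) (punary 2 (pv 1)) (punary 2 (pv 2))])] @
    map (\<lambda>k. ([pFm (pv 0) (pv 1) (pv 2), pFm (pv 0) (pv 3) (pv 4)],
              [pFm (pv 0) (pbinary k (pv 1) (pv 3)) (pbinary k (pv 2) (pv 4))])) [3, 4, 5] @
    map (\<lambda>k. ([pBind (pv 0) (pv 3), pFm (pv 3) (pv 1) (pv 2)],
              [pFm (pv 0) (punary k (pv 1)) (punary k (pv 2))])) [6, 7] @
    [([pFm (pv 0) (pv 1) (pv 2)], [PP (pc 12) (pv 1)])]"

definition PA_basic_axioms :: "fm list" where
  "PA_basic_axioms =
    [Neg (Eq (Succ (Var 0)) Zero), Imp (Eq (Succ (Var 0)) (Succ (Var 1))) (Eq (Var 0) (Var 1)),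
     Eq (Plus (Var 0) Zero) (Var 0),
     Eq (Plus (Var 0) (Succ (Var 1))) (Succ (Plus (Var 0) (Var 1))),
     Eq (Times (Var 0) Zero) Zero,
     Eq (Times (Var 0) (Succ (Var 1))) (Plus (Times (Var 0) (Var 1)) (Var 0)),
     Eq (Expt (Var 0) Zero) (Succ Zero),
     Eq (Expt (Var 0) (Succ (Var 1))) (Times (Expt (Var 0) (Var 1)) (Var 0)),
     Neg (Less (Var 0) Zero),
     Iff (Less (Var 0) (Succ (Var 1))) (Or (Less (Var 0) (Var 1)) (Eq (Var 0) (Var 1)))]"

text \<open>The axiom schemes. The metavariables of a scheme range over codes of formulas, which is
  why \<open>isfm\<close> premises occur; elsewhere an item for an operation ensures the same.\<close>

definition axiom_clauses :: "clause list" where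
  "axiom_clauses = (let a = pv 0; b = pv 1; c = pv 2; d = pv 3; e = pv 4;
      isfm = PP (pc 12); psubst = (\<lambda>u. pFm (psub Zero u)) in
    [([isfm a, isfm b], [pProv (pImp a (pImp b a))]),
     ([isfm a, isfm b, isfm c],
        [pProv (pImp (pImp a (pImp b c)) (pImp (pImp a b) (pImp a c)))]),
     ([isfm a, isfm b], [pProv (pImp (pImp (pNeg a) (pNeg b)) (pImp b a))]),
     ([isfm a, isfm b], [pProv (pImp (pAnd a b) a)]),
     ([isfm a, isfm b], [pProv (pImp (pAnd a b) b)]),
     ([isfm a, isfm b], [pProv (pImp a (pImp b (pAnd a b)))]),
     ([isfm a, isfm b], [pProv (pImp a (pOr a b))]),
     ([isfm a, isfm b], [pProv (pImp b (pOr a b))]),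
     ([isfm a, isfm b, isfm c],
        [pProv (pImp (pImp a c) (pImp (pImp b c) (pImp (pOr a b) c)))]),
     ([psubst d a b], [pProv (pImp (pAll a) b)]),
     ([isfm a, pFm (plift Zero) b c], [pProv (pImp (pAll (pImp c a)) (pImp b (pAll a)))]),
     ([psubst d a b], [pProv (pImp b (pEx a))]),
     ([isfm a, pFm (plift Zero) b c], [pProv (pImp (pAll (pImp a c)) (pImp (pEx a) b))]),
     ([pTm (plift Zero) a b], [pProv (pEq a a)]),
     ([psubst d a b, psubst e a c], [pProv (pImp (pEq d e) (pImp b c))]),
     ([psubst (pTmCode Zero) a b, pFm (plift (Succ Zero)) a c,
       psubst (pTmCode (Succ (Var 0))) c d],
        [pProv (pImp (pAnd b (pAll (pImp a d))) (pAll a))])] @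
    map (\<lambda>\<phi>. ([], [pProv (pc (fm_code \<phi>))])) PA_basic_axioms)"

text \<open>The rules of the calculus, and the properties of a complete theory: it contains what is
  provable, is closed under modus ponens, has no contradictory pair, and decides disjunctions.\<close>

definition completion_clauses :: "clause list" where
  "completion_clauses =
    [([pProv (pImp (pv 0) (pv 1)), pProv (pv 0)], [pProv (pv 1)]),
     ([pProv (pv 0)], [pProv (pAll (pv 0))]),
     ([pProv (pv 0)], [pv 0]),
     ([pImp (pv 0) (pv 1), pv 0], [pv 1]),
     ([pv 0, pNeg (pv 0)], []),
     ([pOr (pv 0) (pv 1)], [pv 0, pv 1])]"

definition PA_clauses :: "clause list" where
  "PA_clauses = op_clauses @ axiom_clauses @ completion_clauses"

lemma PA_clauses_below: "cl \<in> set PA_clauses \<Longrightarrow> clause_below 7 cl"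
  by (auto simp: PA_clauses_def op_clauses_def axiom_clauses_def completion_clauses_def Let_def
      clause_below_def tm_below_num)

section \<open>The standard model satisfies the clauses\<close>

text \<open>The intended set: truth in the standard model for the accepted formulas, validity in the standard
  model for the provable ones, and correct items otherwise. It shows that the tree is infinite, and
  contains the soundness of \<open>PA\<close>.\<close>

inductive_set true_items :: "nat set" where
  true: "sat (\<lambda>_. 0) \<phi> \<Longrightarrow> fm_code \<phi> \<in> true_items"
| valid: "\<forall>e. sat e \<phi> \<Longrightarrow> \<langle>8, fm_code \<phi>\<rangle> \<in> true_items"
| op_tm: "\<langle>9, \<langle>op_code s, \<langle>tm_code t, tm_code (op_tm s t)\<rangle>\<rangle>\<rangle> \<in> true_items"
| op_fm: "\<langle>10, \<langle>op_code s, \<langle>fm_code \<phi>, fm_code (op_fm s \<phi>)\<rangle>\<rangle>\<rangle> \<in> true_items"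
| formula: "\<langle>12, fm_code \<phi>\<rangle> \<in> true_items"
| bind: "\<langle>11, \<langle>op_code s, op_code (bind_op s)\<rangle>\<rangle> \<in> true_items"

lemma fm_code_tag: "k > 7 \<Longrightarrow> \<langle>k, a\<rangle> \<noteq> fm_code \<phi>"
  by (cases \<phi>) auto

lemma true_items_iff [simp]:
  "fm_code \<phi> \<in> true_items \<longleftrightarrow> sat (\<lambda>_. 0) \<phi>"
  "\<langle>8, a\<rangle> \<in> true_items \<longleftrightarrow> (\<exists>\<phi>. a = fm_code \<phi> \<and> (\<forall>e. sat e \<phi>))"
  "\<langle>9, \<langle>a, \<langle>b, c\<rangle>\<rangle>\<rangle> \<in> true_items \<longleftrightarrow>
     (\<exists>s t. a = op_code s \<and> b = tm_code t \<and> c = tm_code (op_tm s t))"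
  "\<langle>10, \<langle>a, \<langle>b, c\<rangle>\<rangle>\<rangle> \<in> true_items \<longleftrightarrow>
     (\<exists>s \<phi>. a = op_code s \<and> b = fm_code \<phi> \<and> c = fm_code (op_fm s \<phi>))"
  "\<langle>12, a\<rangle> \<in> true_items \<longleftrightarrow> (\<exists>\<phi>. a = fm_code \<phi>)"
  "\<langle>11, \<langle>a, b\<rangle>\<rangle> \<in> true_items \<longleftrightarrow> (\<exists>s. a = op_code s \<and> b = op_code (bind_op s))"
  using fm_code_tag by (auto simp: true_items.simps dest: sym)

lemma op_code_cases:
  "\<langle>0, i\<rangle> = op_code s \<longleftrightarrow> s = Lift i"
  "\<langle>1, \<langle>i, a\<rangle>\<rangle> = op_code s \<longleftrightarrow> (\<exists>u. s = Sub i u \<and> a = tm_code u)"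
  by (cases s; auto)+

lemma tm_code_cases:
  "\<langle>0, i\<rangle> = tm_code t \<longleftrightarrow> t = Var i"
  "\<langle>1, 0\<rangle> = tm_code t \<longleftrightarrow> t = Zero"
  "\<langle>2, a\<rangle> = tm_code t \<longleftrightarrow> (\<exists>x. t = Succ x \<and> a = tm_code x)"
  "\<langle>3, \<langle>a, b\<rangle>\<rangle> = tm_code t \<longleftrightarrow> (\<exists>x y. t = Plus x y \<and> a = tm_code x \<and> b = tm_code y)"
  "\<langle>4, \<langle>a, b\<rangle>\<rangle> = tm_code t \<longleftrightarrow> (\<exists>x y. t = Times x y \<and> a = tm_code x \<and> b = tm_code y)"
  "\<langle>5, \<langle>a, b\<rangle>\<rangle> = tm_code t \<longleftrightarrow> (\<exists>x y. t = Expt x y \<and> a = tm_code x \<and> b = tm_code y)"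
  by (cases t; auto)+

lemma fm_code_cases:
  "\<langle>0, \<langle>a, b\<rangle>\<rangle> = fm_code \<phi> \<longleftrightarrow> (\<exists>x y. \<phi> = Eq x y \<and> a = tm_code x \<and> b = tm_code y)"
  "\<langle>1, \<langle>a, b\<rangle>\<rangle> = fm_code \<phi> \<longleftrightarrow> (\<exists>x y. \<phi> = Less x y \<and> a = tm_code x \<and> b = tm_code y)"
  "\<langle>2, a\<rangle> = fm_code \<phi> \<longleftrightarrow> (\<exists>x. \<phi> = Neg x \<and> a = fm_code x)"
  "\<langle>3, \<langle>a, b\<rangle>\<rangle> = fm_code \<phi> \<longleftrightarrow> (\<exists>x y. \<phi> = And x y \<and> a = fm_code x \<and> b = fm_code y)"
  "\<langle>4, \<langle>a, b\<rangle>\<rangle> = fm_code \<phi> \<longleftrightarrow> (\<exists>x y. \<phi> = Or x y \<and> a = fm_code x \<and> b = fm_code y)"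
  "\<langle>5, \<langle>a, b\<rangle>\<rangle> = fm_code \<phi> \<longleftrightarrow> (\<exists>x y. \<phi> = Imp x y \<and> a = fm_code x \<and> b = fm_code y)"
  "\<langle>6, a\<rangle> = fm_code \<phi> \<longleftrightarrow> (\<exists>x. \<phi> = All x \<and> a = fm_code x)"
  "\<langle>7, a\<rangle> = fm_code \<phi> \<longleftrightarrow> (\<exists>x. \<phi> = Ex x \<and> a = fm_code x)"
  by (cases \<phi>; auto)+

text \<open>The form \<open>Suc 0\<close> of the tags is the one that simplification produces.\<close>

lemmas code_cases = op_code_cases[unfolded One_nat_def] tm_code_cases[unfolded One_nat_def]
  fm_code_cases[unfolded One_nat_def]

lemma sat_subst_0: "sat e (subst_fm 0 t \<phi>) \<longleftrightarrow> sat (case_nat (eval e t) e) \<phi>"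
  by (simp add: subst_fm_eq_msub sat_msub)
    (rule arg_cong[where f = "\<lambda>s. sat s \<phi>"], auto simp: fun_eq_iff split: nat.split)

lemma sat_lift_0: "sat (case_nat a e) (lift_fm 0 \<phi>) \<longleftrightarrow> sat e \<phi>"
  by (simp add: lift_fm_eq_msub sat_msub)

lemma sat_lift_1: "sat (case_nat a (case_nat b e)) (lift_fm (Suc 0) \<phi>) \<longleftrightarrow> sat (case_nat a e) \<phi>"
  by (simp add: lift_fm_eq_msub sat_msub)
    (rule arg_cong[where f = "\<lambda>s. sat s \<phi>"], auto simp: fun_eq_iff split: nat.split)

lemma sat_induct:
  "sat (case_nat 0 e) \<phi> \<Longrightarrow> \<forall>a. sat (case_nat a e) \<phi> \<longrightarrow> sat (case_nat (Suc a) e) \<phi> \<Longrightarrow> sat (case_nat a e) \<phi>"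
  by (induction a) auto

lemma op_clauses_true: "\<forall>cl\<in>set op_clauses. satisfies true_items cl"
  by (simp add: op_clauses_def satisfies_def code_cases) auto

lemma axiom_clauses_true: "\<forall>cl\<in>set axiom_clauses. satisfies true_items cl"
  by (simp add: axiom_clauses_def Let_def PA_basic_axioms_def satisfies_def code_cases del: fm_code.simps)
    (auto simp: sat_subst_0 sat_lift_0 sat_lift_1 Iff_def simp del: fm_code.simps intro: sat_induct)

lemma completion_clauses_true: "\<forall>cl\<in>set completion_clauses. satisfies true_items cl"
proof -
  have tag: "\<langle>k, a\<rangle> \<in> true_items \<longleftrightarrow> (\<exists>\<phi>. \<langle>k, a\<rangle> = fm_code \<phi> \<and> sat (\<lambda>_. 0) \<phi>)"
    if "k < 8" for k a
    using that by (auto simp: true_items.simps)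
  show ?thesis
    by (simp add: completion_clauses_def satisfies_def tag code_cases del: fm_code.simps)
      auto
qed

section \<open>Sets that satisfy the clauses\<close>

text \<open>Listing the values of the variables turns a clause into an explicit implication between
  memberships, once the patterns are evaluated. Seven variables are enough for all clauses.\<close>

lemma satisfies_instances:
  assumes "\<forall>cl\<in>set cls. satisfies X cl"
  shows "\<forall>cl\<in>set cls. \<forall>a b c d e f g. (\<forall>p\<in>set (fst cl). pval ((!) [a, b, c, d, e, f, g]) p \<in> X) \<longrightarrow>
    (\<exists>q\<in>set (snd cl). pval ((!) [a, b, c, d, e, f, g]) q \<in> X)"
  using assms unfolding satisfies_def by blast

context
  fixes X
  assumes op: "\<forall>cl\<in>set op_clauses. satisfies X cl"
    and axioms: "\<forall>cl\<in>set axiom_clauses. satisfies X cl"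
    and completion: "\<forall>cl\<in>set completion_clauses. satisfies X cl"
begin

lemmas op_rules = satisfies_instances[OF op, unfolded op_clauses_def, simplified]
lemmas axiom_rules = satisfies_instances[OF axioms, unfolded axiom_clauses_def Let_def, simplified]
lemmas completion_rules = satisfies_instances[OF completion, unfolded completion_clauses_def, simplified]

lemma completion_rule:
  "\<langle>8, \<langle>5, \<langle>a, b\<rangle>\<rangle>\<rangle> \<in> X \<Longrightarrow> \<langle>8, a\<rangle> \<in> X \<Longrightarrow> \<langle>8, b\<rangle> \<in> X"
  "\<langle>8, a\<rangle> \<in> X \<Longrightarrow> \<langle>8, \<langle>6, a\<rangle>\<rangle> \<in> X"
  "\<langle>8, a\<rangle> \<in> X \<Longrightarrow> a \<in> X"
  "\<langle>5, \<langle>a, b\<rangle>\<rangle> \<in> X \<Longrightarrow> a \<in> X \<Longrightarrow> b \<in> X"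
  "a \<in> X \<Longrightarrow> \<langle>2, a\<rangle> \<notin> X"
  "\<langle>4, \<langle>a, b\<rangle>\<rangle> \<in> X \<Longrightarrow> a \<in> X \<or> b \<in> X"
  using completion_rules by metis+

text \<open>The premise says that \<open>s\<close> is known to be an operation. For substitutions this is derived from the
  case of lifting, which is why it is not yet available here.\<close>

lemma tm_item:
  assumes "\<langle>11, \<langle>op_code s, r\<rangle>\<rangle> \<in> X"
  shows "\<langle>9, \<langle>op_code s, \<langle>tm_code t, tm_code (op_tm s t)\<rangle>\<rangle>\<rangle> \<in> X"
proof (induction t)
  case (Var i)
  show ?case
  proof (cases s)
    case (Lift k)
    consider j where "k = Suc (i + j)" | j where "i = k + j"
      using less_iff_Suc_add le_Suc_ex not_less by metis
    then show ?thesis using op_rules by cases (simp_all add: Lift)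
  next
    case (Sub k u)
    have r: "\<exists>r. \<langle>11, \<langle>\<langle>Suc 0, \<langle>k, tm_code u\<rangle>\<rangle>, r\<rangle>\<rangle> \<in> X"
      using assms Sub by auto
    consider j where "k = Suc (i + j)" | "i = k" | j where "i = Suc (k + j)"
      using less_iff_Suc_add linorder_neqE_nat by metis
    then show ?thesis using op_rules r by cases (simp_all add: Sub)
  qed
next
  case Zero
  then show ?case using assms op_rules by auto
qed (use op_rules in simp_all)

lemma bind_item: "\<langle>11, \<langle>op_code s, op_code (bind_op s)\<rangle>\<rangle> \<in> X"
proof -
  have L: "\<langle>11, \<langle>op_code (Lift k), op_code (bind_op (Lift k))\<rangle>\<rangle> \<in> X" for k
    using op_rules by simp
  show ?thesis
  proof (cases s)
    case (Sub k u)
    then show ?thesis using tm_item[OF L, of 0 u] op_rules by simp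
  qed (use L in simp)
qed

lemma fm_item: "\<langle>10, \<langle>op_code s, \<langle>fm_code \<phi>, fm_code (op_fm s \<phi>)\<rangle>\<rangle>\<rangle> \<in> X"
proof (induction \<phi> arbitrary: s)
  case (All \<phi>)
  have "\<langle>10, \<langle>a, \<langle>\<langle>6, b\<rangle>, \<langle>6, c\<rangle>\<rangle>\<rangle>\<rangle> \<in> X"
    if "\<langle>11, \<langle>a, d\<rangle>\<rangle> \<in> X" "\<langle>10, \<langle>d, \<langle>b, c\<rangle>\<rangle>\<rangle> \<in> X" for a b c d
    using op_rules that by blast
  from this[OF bind_item All] show ?case by simp
next
  case (Ex \<phi>)
  have "\<langle>10, \<langle>a, \<langle>\<langle>7, b\<rangle>, \<langle>7, c\<rangle>\<rangle>\<rangle>\<rangle> \<in> X"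
    if "\<langle>11, \<langle>a, d\<rangle>\<rangle> \<in> X" "\<langle>10, \<langle>d, \<langle>b, c\<rangle>\<rangle>\<rangle> \<in> X" for a b c d
    using op_rules that by blast
  from this[OF bind_item Ex] show ?case by simp
qed (use op_rules tm_item[OF bind_item] in simp_all)

lemma subst_item: "\<langle>10, \<langle>\<langle>Suc 0, \<langle>0, tm_code u\<rangle>\<rangle>, \<langle>fm_code \<phi>, fm_code (subst_fm 0 u \<phi>)\<rangle>\<rangle>\<rangle> \<in> X"
  using fm_item[of "Sub 0 u" \<phi>] by simp

lemma lift_item: "\<langle>10, \<langle>\<langle>0, k\<rangle>, \<langle>fm_code \<phi>, fm_code (lift_fm k \<phi>)\<rangle>\<rangle>\<rangle> \<in> X"
  using fm_item[of "Lift k" \<phi>] by simp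

lemma tm_lift_item: "\<langle>9, \<langle>\<langle>0, k\<rangle>, \<langle>tm_code t, tm_code (lift_tm k t)\<rangle>\<rangle>\<rangle> \<in> X"
  using tm_item[OF bind_item, of "Lift k" t] by simp

lemma formula_item: "\<langle>12, fm_code \<phi>\<rangle> \<in> X"
proof -
  have "\<langle>12, b\<rangle> \<in> X" if "\<langle>10, \<langle>a, \<langle>b, c\<rangle>\<rangle>\<rangle> \<in> X" for a b c
    using op_rules that by blast
  from this[OF fm_item] show ?thesis .
qed

text \<open>By induction on the proof, where the items for operations provide the side conditions of the
  quantifier axioms, of Leibniz's law and of induction.\<close>

lemma proof_item: "PA_proves \<phi> \<Longrightarrow> \<langle>8, fm_code \<phi>\<rangle> \<in> X"
proof (induction rule: PA_proves.induct)
  case (Logic \<phi>)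
  then show ?case
  proof cases
    case (AllE \<phi> t)
    show ?thesis using axiom_rules subst_item[of t \<phi>] unfolding AllE fm_code.simps by metis
  next
    case (ExI t \<phi>)
    show ?thesis using axiom_rules subst_item[of t \<phi>] unfolding ExI fm_code.simps by metis
  next
    case (AllI \<psi> \<phi>)
    show ?thesis using axiom_rules lift_item[of 0 \<psi>] formula_item[of \<phi>] unfolding AllI fm_code.simps by metis
  next
    case (ExE \<phi> \<psi>)
    show ?thesis using axiom_rules lift_item[of 0 \<psi>] formula_item[of \<phi>] unfolding ExE fm_code.simps by metis
  next
    case (Refl t)
    show ?thesis using axiom_rules tm_lift_item[of 0 t] unfolding Refl fm_code.simps by metis
  next
    case (Leibniz s t \<phi>)
    show ?thesis using axiom_rules subst_item[of s \<phi>] subst_item[of t \<phi>] unfolding Leibniz fm_code.simps by metis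
  qed (use axiom_rules formula_item in simp_all)
next
  case (Axiom \<phi>)
  then show ?case
  proof cases
    case (Induction \<phi>)
    let ?zero = "\<langle>Suc 0, 0\<rangle>" and ?suc = "\<langle>2, \<langle>0, 0\<rangle>\<rangle>"
    have rule: "\<langle>8, \<langle>5, \<langle>\<langle>3, \<langle>b, \<langle>6, \<langle>5, \<langle>a, d\<rangle>\<rangle>\<rangle>\<rangle>\<rangle>, \<langle>6, a\<rangle>\<rangle>\<rangle>\<rangle> \<in> X"
      if "\<langle>10, \<langle>\<langle>Suc 0, \<langle>0, ?zero\<rangle>\<rangle>, \<langle>a, b\<rangle>\<rangle>\<rangle> \<in> X"
        and "\<langle>10, \<langle>\<langle>0, Suc 0\<rangle>, \<langle>a, c\<rangle>\<rangle>\<rangle> \<in> X"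
        and "\<langle>10, \<langle>\<langle>Suc 0, \<langle>0, ?suc\<rangle>\<rangle>, \<langle>c, d\<rangle>\<rangle>\<rangle> \<in> X"
      for a b c d
      using axiom_rules that by metis
    show ?thesis
      using rule[OF _ lift_item[of "Suc 0" \<phi>]] subst_item[of Zero \<phi>] subst_item[of "Succ (Var 0)" "lift_fm 1 \<phi>"]
      by (simp add: Induction)
  qed (use axiom_rules in \<open>simp_all add: PA_basic_axioms_def Iff_def\<close>)
next
  case (MP \<phi> \<psi>)
  then show ?case using completion_rule(1) by simp
next
  case (Gen \<phi>)
  then show ?case using completion_rule(2) by simp
qed

text \<open>A two-valued function is a probability function if the formulas of value 1 form a complete theory
  that contains \<open>PA\<close>. For disjoint \<open>\<phi>\<close> and \<open>\<psi>\<close> at most one of them has the value 1.\<close>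

lemma completion_ded_closed_prob:
  "ded_closed_prob (\<lambda>\<phi>. if fm_code \<phi> \<in> X then 1 else 0)"
proof -
  have th: "fm_code \<phi> \<in> X" if "PA_proves \<phi>" for \<phi>
    using completion_rule(3) proof_item[OF that] by blast
  have mp: "fm_code \<psi> \<in> X" if "fm_code (Imp \<phi> \<psi>) \<in> X" "fm_code \<phi> \<in> X" for \<phi> \<psi>
    using completion_rule(4) that by simp
  have neg: "fm_code (Neg \<phi>) \<notin> X \<or> fm_code \<phi> \<notin> X" for \<phi>
    using completion_rule(5) by auto
  have disj: "fm_code \<phi> \<in> X \<or> fm_code \<psi> \<in> X" if "fm_code (Or \<phi> \<psi>) \<in> X" for \<phi> \<psi>
    using completion_rule(6) that by simp
  have "fm_code (Or \<phi> \<psi>) \<in> X \<longleftrightarrow> fm_code \<phi> \<in> X \<or> fm_code \<psi> \<in> X" for \<phi> \<psi>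
    using disj mp[OF th[OF Logic[OF OrI1]]] mp[OF th[OF Logic[OF OrI2]]] by blast
  moreover have "fm_code \<phi> \<notin> X \<or> fm_code \<psi> \<notin> X" if "PA_proves (Neg (And \<phi> \<psi>))" for \<phi> \<psi>
    using neg th[OF that] mp[OF mp[OF th[OF Logic[OF AndI]]]] by blast
  ultimately show ?thesis
    using th unfolding ded_closed_prob_def by auto
qed

end

section \<open>A definable probability function\<close>

lemma rat_code_eq_iff: "rat_code p = rat_code q \<longleftrightarrow> p = q"
proof
  assume "rat_code p = rat_code q"
  moreover have "snd (quotient_of p) > 0" "snd (quotient_of q) > 0"
    by (simp_all add: quotient_of_denom_pos')
  ultimately have "quotient_of p = quotient_of q"
    by (cases "quotient_of p"; cases "quotient_of q")
      (auto simp: rat_code_def prod_encode_eq inj_eq[OF inj_int_encode])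
  then show "p = q" by (metis quotient_of_inject_eq)
qed simp

theorem theorem5:
  shows "\<exists>P :: fm \<Rightarrow> real. ded_closed_prob P \<and>
    definable (Delta_fm 2) 1 Sent_fm sentence_codes (\<lambda>xs. P (inv fm_code (hd xs)))"
proof -
  define T where "T = path 7 PA_clauses"
  define P :: "fm \<Rightarrow> real" where "P \<phi> = (if fm_code \<phi> \<in> T then 1 else 0)" for \<phi>
  define g :: "nat list \<Rightarrow> rat" where "g xs = (if hd xs \<in> T then 1 else 0)" for xs
  define \<Phi> where "\<Phi> = select_fm (rat_code 1) (rat_code 0) (tree_fm 7 PA_clauses)"
  have true: "satisfies true_items cl" if "cl \<in> set PA_clauses" for cl
    using that op_clauses_true axiom_clauses_true completion_clauses_true
    by (auto simp: PA_clauses_def)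
  have T: "\<forall>cl\<in>set PA_clauses. satisfies T cl"
    unfolding T_def using path_satisfies[OF true] by blast
  have "ded_closed_prob P"
    using completion_ded_closed_prob[of T] T unfolding P_def PA_clauses_def by simp
  moreover have "definable (Delta_fm 2) 1 Sent_fm sentence_codes (\<lambda>xs. P (inv fm_code (hd xs)))"
    unfolding definable_def
  proof (intro conjI exI)
    show "defines_set 1 Sent_fm sentence_codes" by (rule defines_set_Sent_fm)
    show "approximates sentence_codes g (\<lambda>xs. P (inv fm_code (hd xs)))"
      by (auto simp: approximates_def sentence_codes_def g_def P_def inj_fm_code)
    show "Delta_fm 2 \<Phi>"
      unfolding \<Phi>_def by (rule Delta_select_fm[OF PA_tree_fm bounded_tree_fm])
    show "defines_rat_fun (Suc 1) Sent_fm (times_omega sentence_codes) \<Phi> g"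
      unfolding defines_rat_fun_def
    proof (intro conjI ballI allI)
      have "fm_below 2 Sent_fm"
        using defines_set_Sent_fm by (auto simp: defines_set_def intro: fm_below_mono)
      moreover have "times_omega sentence_codes = {xs. length xs = Suc 1 \<and> holds Sent_fm xs}"
        by (auto simp: times_omega_def sentence_codes_def holds_def sat_Sent_fm_iff length_Suc_conv)
      ultimately show "defines_set (Suc 1) Sent_fm (times_omega sentence_codes)"
        by (simp add: defines_set_def numeral_2_eq_2)
      show "fm_below (Suc (Suc 1)) \<Phi>"
        using fm_below_select_fm by (simp add: \<Phi>_def numeral_3_eq_3)
      show "g xs = q \<longleftrightarrow> holds \<Phi> (rat_code q # xs)" if "xs \<in> times_omega sentence_codes" for xs q
      proof -
        have "holds \<Phi> (rat_code q # xs) \<longleftrightarrow>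
            rat_code q = (if hd xs \<in> T then rat_code 1 else rat_code 0)"
          using that PA_clauses_below
          by (auto simp: \<Phi>_def holds_def sat_select_tree_fm T_def times_omega_def sentence_codes_def)
        then show ?thesis by (auto simp: g_def rat_code_eq_iff)
      qed
      have "PA_proves (Imp Sent_fm (Ex1 \<Phi>))"
        unfolding \<Phi>_def by (rule MP[OF Logic[OF K] PA_select_fm(2)[OF PA_tree_fm]])
      then show "PA_proves ((All ^^ Suc 1) (Imp Sent_fm (Ex1 \<Phi>)))"
        by (simp add: Gen)
    qed
  qed
  ultimately show ?thesis by blast
qed

end
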